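(* Let $k = p_1p_2\cdots p_t \equiv 0 \pmod 4$, where $p_1,\dots,p_t$ are primes, not necessarily distinct; let $1 < i \leq t-1$, $r = p_1p_2\cdots p_i$ and $s = p_{i+1}p_{i+2}\cdots p_t$. If $u = rx+1$ for a positive integer $x \neq 2$, and $g$ is odd with $g \equiv s \pmod{2s}$, then there exists a $k$-ARCS of $K_u \times K_g$.
   Context: For graphs $G,H$, the tensor product $G \times H$ has vertex set $V(G)\times V(H)$, with $(g_1,h_1)$ adjacent to $(g_2,h_2)$ iff $g_1g_2 \in E(G)$ and $h_1h_2 \in E(H)$. $K_n$ is the complete graph on $n$ vertices. $K_u \times K_g$ is regarded as a $u$-partite graph with partite sets $V_j = \{j\}\times V(K_g)$. A partial $C_k$-factor of $K_u \times K_g$ is a subgraph which, for some $j$, is a spanning subgraph of $(K_u \times K_g)\setminus V_j$ all of whose components are cycles of length $k$. A $k$-ARCS of $K_u \times K_g$ is a partition of its edge set into partial $C_k$-factors. *)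

theory Defs
  imports "HOL-Library.Disjoint_Sets" "HOL-Number_Theory.Cong" "HOL-Computational_Algebra.Primes"
begin

record 'a sgraph =
  verts :: "'a set"
  edges :: "'a set set"

definition simple_graph :: "'a sgraph \<Rightarrow> bool" where
  "simple_graph G \<longleftrightarrow>
     (\<forall>e\<in>edges G. \<exists>a\<in>verts G. \<exists>b\<in>verts G. a \<noteq> b \<and> e = {a, b})"

definition subgraph :: "'a sgraph \<Rightarrow> 'a sgraph \<Rightarrow> bool" where
  "subgraph H G \<longleftrightarrow>
     simple_graph H \<and> verts H \<subseteq> verts G \<and> edges H \<subseteq> edges G"

definition spanning_subgraph :: "'a sgraph \<Rightarrow> 'a sgraph \<Rightarrow> bool" where
  "spanning_subgraph H G \<longleftrightarrow> subgraph H G \<and> verts H = verts G"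

definition induced :: "'a sgraph \<Rightarrow> 'a set \<Rightarrow> 'a sgraph" where
  "induced G W = \<lparr>verts = verts G \<inter> W, edges = {e \<in> edges G. e \<subseteq> W}\<rparr>"

definition remove_verts :: "'a sgraph \<Rightarrow> 'a set \<Rightarrow> 'a sgraph" where
  "remove_verts G S = induced G (verts G - S)"

definition components :: "'a sgraph \<Rightarrow> 'a sgraph set" where
  "components G =
     {induced G {w. (v, w) \<in> {(a, b). {a, b} \<in> edges G}\<^sup>*} | v. v \<in> verts G}"

definition is_cycle_graph :: "nat \<Rightarrow> 'a sgraph \<Rightarrow> bool" where
  "is_cycle_graph k G \<longleftrightarrow> 3 \<le> k \<and>
     (\<exists>c. length c = k \<and> distinct c \<and> verts G = set c \<and>
          edges G = {{c ! m, c ! (Suc m mod k)} | m. m < k})"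

definition complete_graph :: "nat \<Rightarrow> nat sgraph" where
  "complete_graph n = \<lparr>verts = {..<n}, edges = {{a, b} | a b. a < n \<and> b < n \<and> a \<noteq> b}\<rparr>"

definition tensor_product :: "'a sgraph \<Rightarrow> 'b sgraph \<Rightarrow> ('a \<times> 'b) sgraph" where
  "tensor_product G H =
     \<lparr>verts = verts G \<times> verts H,
      edges = {{(g1, h1), (g2, h2)} | g1 h1 g2 h2. {g1, g2} \<in> edges G \<and> {h1, h2} \<in> edges H}\<rparr>"

definition partite_set :: "nat \<Rightarrow> nat \<Rightarrow> (nat \<times> nat) set" where
  "partite_set g j = {j} \<times> verts (complete_graph g)"

definition partial_cycle_factor :: "nat \<Rightarrow> nat \<Rightarrow> nat \<Rightarrow> (nat \<times> nat) sgraph \<Rightarrow> bool" where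
  "partial_cycle_factor k u g F \<longleftrightarrow>
     (\<exists>j \<in> verts (complete_graph u).
        spanning_subgraph F
          (remove_verts (tensor_product (complete_graph u) (complete_graph g)) (partite_set g j)) \<and>
        (\<forall>C \<in> components F. is_cycle_graph k C))"

text \<open>The classes of the partition are edge sets; each must be the edge set of a partial
  \<open>C\<^sub>k\<close>-factor, which is determined by it as a factor has no isolated vertices.\<close>

definition is_ARCS :: "nat \<Rightarrow> nat \<Rightarrow> nat \<Rightarrow> (nat \<times> nat) set set set \<Rightarrow> bool" where
  "is_ARCS k u g P \<longleftrightarrow>
     partition_on (edges (tensor_product (complete_graph u) (complete_graph g))) P \<and>
     (\<forall>A\<in>P. \<exists>F. partial_cycle_factor k u g F \<and> edges F = A)"

end

theory Submission
  imports Defs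
begin

text \<open>
  Since \<open>g\<close> is odd, so is \<open>s\<close>; hence \<open>r = 4m\<close> and \<open>g = s w\<close> with \<open>w\<close> odd.  Start from a decomposition of
  the twofold complete graph on \<open>u = rx + 1\<close> points into near factors made of \<open>r\<close>-cycles, one near
  factor for each missing point, whose cycles are oriented alternately so that every ordered pair of
  points is an arc exactly once.  Giving the arcs voltages from a half-set \<open>H\<close> of \<open>\<int>/g\<close> (one of each
  pair \<open>\<plusminus>h\<close>) lifts every near factor to \<open>(g - 1)/2\<close> partial factors of the tensor product, and the total
  voltage of a cycle determines the length of its lifts.  An alternating orientation with constant
  voltage gives total \<open>0\<close>; shifting the voltage on two marked edges of equal orientation makes the total an
  element of order \<open>s\<close>, so that all lifted cycles have length \<open>r s = k\<close>.  The two shifts available are by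
  \<open>w\<close> on the voltages not divisible by \<open>w\<close>, and by \<open>w (s - 1)/2\<close>, which turns \<open>H\<close> into \<open>-H\<close>, on the others;
  that marked arcs occur in both directions keeps the voltages on each edge complementary.

  For \<open>x = 1\<close> the near factors are the translates of a graceful \<open>4m\<close>-cycle.  In general, split the points
  other than \<open>\<infinity>\<close> into \<open>x\<close> groups of size \<open>r\<close>.  An idempotent quasigroup of order \<open>x\<close> (this needs \<open>x \<noteq> 2\<close>)
  gives for each group \<open>j\<close> a permutation of the groups fixing only \<open>j\<close>; along each of its arcs a half of one group is
  joined to a half of the next by Hamiltonian cycles of \<open>K\<^bsub>2m,2m\<^esub>\<close>, and the halves are selected by a
  proper 3-colouring of the permutation.  Group \<open>j\<close> together with \<open>\<infinity>\<close> is filled with the solution for \<open>x = 1\<close>.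
\<close>

section \<open>Graphs traced by permutations\<close>

text \<open>Since \<open>\<phi> ^^ k\<close> is the identity on \<open>U\<close>, a predecessor of
  an orbit point is again in the orbit. Undirected reachability therefore never leaves the forward
  orbit, and the exact period makes its first \<open>k\<close> points distinct.\<close>

lemma funpow_orbit_cycle_components:
  fixes \<phi> :: "'a \<Rightarrow> 'a"
  assumes k: "3 \<le> k"
    and closed: "\<And>x. x \<in> U \<Longrightarrow> \<phi> x \<in> U"
    and period: "\<And>x i. x \<in> U \<Longrightarrow> (\<phi> ^^ i) x = x \<longleftrightarrow> k dvd i"
    and F: "F = \<lparr>verts = U, edges = {{x, \<phi> x} | x. x \<in> U}\<rparr>"
    and C: "C \<in> components F"
  shows "is_cycle_graph k C"
proof -
  let ?R = "{(a, b). {a, b} \<in> edges F}"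
  from C F obtain v where v: "v \<in> U" and Cv: "C = induced F {w. (v, w) \<in> ?R\<^sup>*}"
    by (auto simp: components_def)
  have inU: "(\<phi> ^^ i) x \<in> U" if "x \<in> U" for x i
    using that by (induction i) (auto intro: closed)
  define orb where "orb = range (\<lambda>i. (\<phi> ^^ i) v)"
  have perk: "(\<phi> ^^ k) x = x" if "x \<in> U" for x
    using period[OF that, of k] by simp
  have orbU: "orb \<subseteq> U"
    using inU v by (auto simp: orb_def)
  have orb_step: "\<phi> x \<in> orb" if "x \<in> orb" for x
  proof -
    from that obtain i where "x = (\<phi> ^^ i) v" by (auto simp: orb_def)
    hence "\<phi> x = (\<phi> ^^ Suc i) v" by simp
    thus ?thesis unfolding orb_def by blast
  qed
  have orb_pow: "(\<phi> ^^ i) x \<in> orb" if "x \<in> orb" for x i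
    using that by (induction i) (auto intro: orb_step)
  have orb_back: "y \<in> orb" if "\<phi> y \<in> orb" "y \<in> U" for y
  proof -
    have "(\<phi> ^^ k) y = (\<phi> ^^ (k - 1)) (\<phi> y)"
      using k by (metis One_nat_def Suc_diff_1 comp_apply funpow_Suc_right less_le_trans zero_less_numeral)
    thus ?thesis using perk[OF that(2)] orb_pow[OF that(1)] by metis
  qed
  have reach: "{w. (v, w) \<in> ?R\<^sup>*} = orb"
  proof
    have "w \<in> orb" if "(v, w) \<in> ?R\<^sup>*" for w
      using that
    proof induction
      case base
      show ?case unfolding orb_def by (rule range_eqI[of _ _ 0]) simp
    next
      case (step y z)
      then obtain x where x: "x \<in> U" "{y, z} = {x, \<phi> x}" by (auto simp: F)
      hence "(y = x \<and> z = \<phi> x) \<or> (y = \<phi> x \<and> z = x)" by (auto simp: doubleton_eq_iff)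
      thus ?case using step.IH orb_step orb_back x(1) by metis
    qed
    thus "{w. (v, w) \<in> ?R\<^sup>*} \<subseteq> orb" by blast
    have "(v, (\<phi> ^^ i) v) \<in> ?R\<^sup>*" for i
    proof (induction i)
      case (Suc i)
      have "((\<phi> ^^ i) v, (\<phi> ^^ Suc i) v) \<in> ?R"
        using inU[OF v, of i] by (auto simp: F)
      with Suc show ?case by (rule rtrancl_into_rtrancl)
    qed simp
    thus "orb \<subseteq> {w. (v, w) \<in> ?R\<^sup>*}" by (auto simp: orb_def)
  qed
  have C_eq: "C = induced F orb"
    unfolding Cv reach ..
  define c where "c = map (\<lambda>i. (\<phi> ^^ i) v) [0..<k]"
  have modk: "(\<phi> ^^ i) v = (\<phi> ^^ (i mod k)) v" for i
  proof -
    have "(\<phi> ^^ (k * n)) x = x" if "x \<in> U" for n x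
      using period[OF that] by simp
    from this[OF inU[OF v], of "i div k" "i mod k"]
    show ?thesis by (metis comp_apply funpow_add mult_div_mod_eq)
  qed
  have set_c: "set c = orb"
  proof -
    have "(\<phi> ^^ i) v \<in> (\<lambda>i. (\<phi> ^^ i) v) ` {0..<k}" for i
      using k by (subst modk) (intro imageI, simp)
    thus ?thesis by (auto simp: c_def orb_def)
  qed
  have neq: "(\<phi> ^^ i) v \<noteq> (\<phi> ^^ j) v" if "i < j" "j < k" for i j
  proof
    assume eq: "(\<phi> ^^ i) v = (\<phi> ^^ j) v"
    have "(\<phi> ^^ (j - i)) ((\<phi> ^^ i) v) = (\<phi> ^^ i) v"
      using eq that by (metis add.commute comp_apply funpow_add le_add_diff_inverse less_imp_le)
    hence "k dvd j - i" using period[OF inU[OF v]] by blast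
    with that show False by (auto dest: dvd_imp_le)
  qed
  have "distinct c"
    unfolding c_def distinct_map by (auto simp: inj_on_def) (metis neq linorder_neqE_nat)
  moreover have "edges C = {{c ! m, c ! (Suc m mod k)} | m. m < k}"
  proof -
    have nth: "{c ! m, c ! (Suc m mod k)} = {(\<phi> ^^ m) v, \<phi> ((\<phi> ^^ m) v)}" if "m < k" for m
      using that k modk[of "Suc m"] by (simp add: c_def)
    have "edges C = {{x, \<phi> x} | x. x \<in> orb}"
      using orbU orb_step by (auto simp: C_eq induced_def F)
    also have "\<dots> = (\<lambda>m. {(\<phi> ^^ m) v, \<phi> ((\<phi> ^^ m) v)}) ` {..<k}"
      unfolding set_c[symmetric] by (auto simp: c_def)
    also have "\<dots> = (\<lambda>m. {c ! m, c ! (Suc m mod k)}) ` {..<k}"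
      by (rule image_cong) (simp_all add: nth)
    also have "\<dots> = {{c ! m, c ! (Suc m mod k)} | m. m < k}" by auto
    finally show ?thesis .
  qed
  moreover have "verts C = set c"
    using orbU by (auto simp: C_eq induced_def F set_c)
  moreover have "length c = k" by (simp add: c_def)
  ultimately show ?thesis
    unfolding is_cycle_graph_def using k by blast
qed

section \<open>Sums of periodic sequences\<close>

lemma sum_shift_periodic:
  fixes v :: "nat \<Rightarrow> int"
  assumes "\<And>t. v (t + r) = v t"
  shows "(\<Sum>j<r. v (t + j)) = (\<Sum>j<r. v j)"
proof (induction t)
  case (Suc t)
  have "(\<Sum>j<r. v (Suc t + j)) + v t = (\<Sum>j<Suc r. v (t + j))"
    by (subst sum.lessThan_Suc_shift) simp
  also have "\<dots> = (\<Sum>j<r. v (t + j)) + v t" using assms by simp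
  finally show ?case using Suc by simp
qed simp

lemma sum_periodic_mult:
  fixes v :: "nat \<Rightarrow> int"
  assumes "\<And>t. v (t + r) = v t"
  shows "(\<Sum>j<r * q. v (t + j)) = int q * (\<Sum>j<r. v j)"
proof (induction q)
  case (Suc q)
  have split: "(\<Sum>j<a + b. f j) = (\<Sum>j<a. f j) + (\<Sum>j<b. f (a + j))" for a b and f :: "nat \<Rightarrow> int"
    by (induction b) auto
  have "(\<Sum>j<r * Suc q. v (t + j)) = (\<Sum>j<r * q + r. v (t + j))" by (simp add: add.commute)
  also have "\<dots> = (\<Sum>j<r * q. v (t + j)) + (\<Sum>j<r. v (t + (r * q + j)))"
    by (rule split)
  also have "(\<Sum>j<r. v (t + (r * q + j))) = (\<Sum>j<r. v j)"
    using sum_shift_periodic[of v r "t + r * q", OF assms] by (simp add: add_ac)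
  finally show ?case using Suc by (simp add: algebra_simps)
qed simp

section \<open>Oriented near factorizations\<close>

text \<open>\<open>c\<close> runs periodically over all natural numbers, so iterates of
  \<open>nxt\<close> are simply later terms. The two marked positions have equal parity, hence equal
  orientation, so that their shifts add up instead of cancelling.\<close>

definition alternating_cycle ::
  "nat \<Rightarrow> (nat \<Rightarrow> 'a) \<Rightarrow> 'a set \<Rightarrow> ('a \<Rightarrow> 'a) \<Rightarrow> ('a \<Rightarrow> bool) \<Rightarrow> ('a \<Rightarrow> 'a \<Rightarrow> bool) \<Rightarrow> bool" where
  "alternating_cycle r c W nxt fwd ty \<longleftrightarrow>
     (\<forall>t. c t \<in> W) \<and> (\<forall>t. nxt (c t) = c (Suc t)) \<and>
     (\<forall>t t'. c t = c t' \<longleftrightarrow> t mod r = t' mod r) \<and> (\<forall>t. fwd (c t) \<longleftrightarrow> even t) \<and>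
     (\<exists>t1 t2. t1 < t2 \<and> t2 < r \<and> even t1 = even t2 \<and>
        (\<forall>t<r. ty (c t) (c (Suc t)) \<longleftrightarrow> t = t1 \<or> t = t2))"

text \<open>\<open>nxt p\<close> traces the near factor that misses \<open>p\<close>;
  \<open>fwd p a\<close> says whether the edge from \<open>a\<close> to \<open>nxt p a\<close> is
  oriented along the trace. The assumption \<open>arc\<close> asks only for existence; uniqueness
  follows by counting.\<close>

locale near_factorization =
  fixes r :: nat and V :: "'a set"
    and nxt :: "'a \<Rightarrow> 'a \<Rightarrow> 'a" and fwd :: "'a \<Rightarrow> 'a \<Rightarrow> bool" and ty :: "'a \<Rightarrow> 'a \<Rightarrow> bool"
  assumes finite_V: "finite V"
    and even_r: "even r" "0 < r"
    and ty_sym: "ty a b = ty b a"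
    and cycle: "\<lbrakk>p \<in> V; a \<in> V; a \<noteq> p\<rbrakk>
      \<Longrightarrow> \<exists>c. alternating_cycle r c (V - {p}) (nxt p) (fwd p) ty \<and> a \<in> range c"
    and arc: "\<lbrakk>a \<in> V; b \<in> V; a \<noteq> b\<rbrakk> \<Longrightarrow> \<exists>p\<in>V. p \<noteq> a \<and> p \<noteq> b \<and>
      ((nxt p a = b \<and> fwd p a) \<or> (nxt p b = a \<and> \<not> fwd p b))"

text \<open>Over an even number of terms the constant part cancels; the two marked terms carry the
  same sign, which leaves twice the shift.\<close>

lemma sum_alternating:
  fixes r :: nat and x d :: int
  assumes "even r" "t1 < t2" "t2 < r" "even t1 = even t2"
    and "\<And>t. t < r \<Longrightarrow> P t \<longleftrightarrow> t = t1 \<or> t = t2"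
  shows "(\<Sum>t<r. (if even t then 1 else -1) * (if P t then x + d else x)) =
    (if even t1 then 1 else -1) * (2 * d)"
proof -
  let ?e = "\<lambda>t::nat. if even t then 1 else -1 :: int"
  have z: "(\<Sum>t<r. ?e t) = 0"
  proof -
    obtain q where "r = 2 * q" using assms(1) by auto
    moreover have "(\<Sum>t<2 * q. ?e t) = 0" by (induction q) auto
    ultimately show ?thesis by simp
  qed
  have "(\<Sum>t<r. ?e t * (if P t then x + d else x)) =
    (\<Sum>t<r. ?e t * x + ((if t = t1 then ?e t1 * d else 0) + (if t = t2 then ?e t2 * d else 0)))"
    using assms by (intro sum.cong) (auto simp: algebra_simps)
  also have "\<dots> = ?e t1 * (2 * d)"
    using assms z by (simp add: sum.distrib sum_distrib_right[symmetric])
  finally show ?thesis .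
qed

text \<open>By \<open>arc\<close> the map covers its own finite domain, so it is injective: every
  ordered pair of distinct points is an arc exactly once.\<close>

lemma (in near_factorization) inj_on_arc:
  "inj_on (\<lambda>(p, a). if fwd p a then (a, nxt p a) else (nxt p a, a)) {(p, a). p \<in> V \<and> a \<in> V \<and> p \<noteq> a}"
proof (rule finite_surj_inj)
  show "finite {(p, a). p \<in> V \<and> a \<in> V \<and> p \<noteq> a}"
    by (rule finite_subset[of _ "V \<times> V"]) (auto simp: finite_V)
  show "{(p, a). p \<in> V \<and> a \<in> V \<and> p \<noteq> a} \<subseteq>
    (\<lambda>(p, a). if fwd p a then (a, nxt p a) else (nxt p a, a)) ` {(p, a). p \<in> V \<and> a \<in> V \<and> p \<noteq> a}"
  proof clarify
    fix a b assume ab: "a \<in> V" "b \<in> V" "a \<noteq> b"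
    from arc[OF this] obtain p where p: "p \<in> V" "p \<noteq> a" "p \<noteq> b"
      "(nxt p a = b \<and> fwd p a) \<or> (nxt p b = a \<and> \<not> fwd p b)" by blast
    from p(4) show "(a, b) \<in> (\<lambda>(p, a). if fwd p a then (a, nxt p a) else (nxt p a, a)) `
        {(p, a). p \<in> V \<and> a \<in> V \<and> p \<noteq> a}"
    proof
      assume "nxt p a = b \<and> fwd p a"
      thus ?thesis using ab p by (intro image_eqI[of _ _ "(p, a)"]) auto
    next
      assume "nxt p b = a \<and> \<not> fwd p b"
      thus ?thesis using ab p by (intro image_eqI[of _ _ "(p, b)"]) auto
    qed
  qed
qed

lemma (in near_factorization) nxt_in:
  assumes "p \<in> V" "a \<in> V" "a \<noteq> p"
  shows "nxt p a \<in> V" "nxt p a \<noteq> p"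
  using cycle[OF assms] by (auto simp: alternating_cycle_def)

lemma (in near_factorization) nxt_neq:
  assumes "p \<in> V" "a \<in> V" "a \<noteq> p"
  shows "nxt p a \<noteq> a"
proof -
  from cycle[OF assms] obtain c t where c: "alternating_cycle r c (V - {p}) (nxt p) (fwd p) ty" "a = c t"
    by auto
  hence "fwd p (nxt p a) \<noteq> fwd p a" by (auto simp: alternating_cycle_def)
  thus ?thesis by auto
qed

text \<open>The construction lives on pairs with an added infinite point, while the partite sets are
  numbered from \<open>0\<close> to \<open>u - 1\<close>; this passes from one to the other.\<close>

lemma near_factorization_transfer:
  assumes nf: "near_factorization r V nxt fwd ty" and f: "bij_betw f V W"
  shows "\<exists>nxt' fwd' ty'. near_factorization r W nxt' fwd' ty'"
proof -
  interpret near_factorization r V nxt fwd ty by fact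
  define h where "h = inv_into V f"
  have hf: "h (f a) = a" if "a \<in> V" for a
    using f that by (simp add: h_def bij_betw_inv_into_left)
  have fh: "f (h a) = a" "h a \<in> V" if "a \<in> W" for a
    using f that by (auto simp: h_def bij_betw_inv_into_right bij_betw_def intro: inv_into_into)
  have fV: "f a \<in> W" if "a \<in> V" for a
    using f that by (auto simp: bij_betw_def)
  have inj: "f a = f b \<longleftrightarrow> a = b" if "a \<in> V" "b \<in> V" for a b
    using hf that by metis
  have hinj: "h a = h b \<longleftrightarrow> a = b" if "a \<in> W" "b \<in> W" for a b
    using fh that by metis
  have "near_factorization r W (\<lambda>p a. f (nxt (h p) (h a))) (\<lambda>p a. fwd (h p) (h a)) (\<lambda>a b. ty (h a) (h b))"
  proof
    show "finite W" using f finite_V bij_betw_finite by blast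
    show "even r" "0 < r" by (fact even_r)+
    show "ty (h a) (h b) = ty (h b) (h a)" for a b by (rule ty_sym)
    show "\<exists>c. alternating_cycle r c (W - {p}) (\<lambda>a. f (nxt (h p) (h a))) (\<lambda>a. fwd (h p) (h a)) (\<lambda>a b. ty (h a) (h b))
        \<and> a \<in> range c" if "p \<in> W" "a \<in> W" "a \<noteq> p" for p a
    proof -
      from cycle[of "h p" "h a"] that hinj fh obtain c where
        c: "alternating_cycle r c (V - {h p}) (nxt (h p)) (fwd (h p)) ty" "h a \<in> range c" by metis
      from c(1) have cV: "c t \<in> V" "c t \<noteq> h p" for t by (auto simp: alternating_cycle_def)
      have "f (c t) \<noteq> p" for t using cV[of t] hf by metis
      hence "alternating_cycle r (f \<circ> c) (W - {p}) (\<lambda>a. f (nxt (h p) (h a))) (\<lambda>a. fwd (h p) (h a)) (\<lambda>a b. ty (h a) (h b))"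
        using c(1) cV fV by (simp add: alternating_cycle_def hf inj)
      moreover have "a \<in> range (f \<circ> c)"
        using c(2) fh(1)[OF that(2)] by (auto simp: image_iff)
      ultimately show ?thesis by blast
    qed
    show "\<exists>p\<in>W. p \<noteq> a \<and> p \<noteq> b \<and> (f (nxt (h p) (h a)) = b \<and> fwd (h p) (h a) \<or>
        f (nxt (h p) (h b)) = a \<and> \<not> fwd (h p) (h b))" if "a \<in> W" "b \<in> W" "a \<noteq> b" for a b
    proof -
      from arc[of "h a" "h b"] that hinj fh obtain p where p: "p \<in> V" "p \<noteq> h a" "p \<noteq> h b"
        "(nxt p (h a) = h b \<and> fwd p (h a)) \<or> (nxt p (h b) = h a \<and> \<not> fwd p (h b))" by metis
      hence "f p \<noteq> a" "f p \<noteq> b" using hf by auto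
      thus ?thesis using p fh(1)[OF that(1)] fh(1)[OF that(2)] by (intro bexI[of _ "f p"]) (auto simp: hf fV)
    qed
  qed
  thus ?thesis by blast
qed

section \<open>Voltages\<close>

text \<open>The half-set of non-zero residues modulo \<open>g = s * w\<close> from which the voltages are drawn, and
  the shift that the voltage undergoes on the two marked edges of a cycle.  Doubling the shift gives
  \<open>2 * w\<close> or \<open>- w\<close>, both of order \<open>s\<close> modulo \<open>g\<close>.\<close>

definition half_set :: "int \<Rightarrow> int \<Rightarrow> int set" where
  "half_set s w = {v \<in> {0<..<s * w}. v mod w \<in> {1..w div 2} \<or> (w dvd v \<and> v div w \<le> s div 2)}"

definition shift :: "int \<Rightarrow> int \<Rightarrow> int \<Rightarrow> int" where
  "shift s w v = (if w dvd v then w * (s div 2) else w)"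

definition voltage :: "int \<Rightarrow> int \<Rightarrow> bool \<Rightarrow> int \<Rightarrow> int" where
  "voltage s w b v = (if b then v + shift s w v else v)"

text \<open>After cancelling \<open>w\<close>, the factor of \<open>q\<close> that remains is
  \<open>s - 1\<close> or \<open>2\<close>, and both are units modulo \<open>s\<close>.\<close>

lemma double_shift_order:
  assumes s: "odd s" "0 < s" and w: "0 < w"
  shows "s * w dvd q * (2 * shift s w v) \<longleftrightarrow> s dvd q"
proof -
  have cop: "coprime s 2" using s by (simp add: coprime_right_2_iff_odd)
  show ?thesis
  proof (cases "w dvd v")
    case True
    obtain n where n: "s = 2 * n + 1" using s by (auto elim: oddE)
    have "q * (2 * shift s w v) = (q * (s - 1)) * w" using True n by (simp add: shift_def)
    hence "s * w dvd q * (2 * shift s w v) \<longleftrightarrow> s dvd q * (s - 1)"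
      using w by (metis dvd_mult_cancel_right less_irrefl)
    also have "\<dots> \<longleftrightarrow> s dvd q"
      by (metis dvd_add_right_iff dvd_triv_right minus_dvd_iff dvd_minus_iff mult.right_neutral right_diff_distrib' diff_conv_add_uminus)
    finally show ?thesis .
  next
    case False
    have "q * (2 * shift s w v) = (q * 2) * w" using False by (simp add: shift_def)
    hence "s * w dvd q * (2 * shift s w v) \<longleftrightarrow> s dvd q * 2"
      using w by (metis dvd_mult_cancel_right less_irrefl)
    also have "\<dots> \<longleftrightarrow> s dvd q" using cop by (simp add: coprime_dvd_mult_left_iff)
    finally show ?thesis .
  qed
qed


lemma shift_mod_w: "(v + shift s w v) mod w = v mod w"
  by (auto simp: shift_def)

lemma voltage_mod_w: "voltage s w b v mod w = v mod w"
  by (auto simp: voltage_def shift_mod_w)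

lemma half_set_multipleE:
  assumes "v \<in> half_set s w" "w dvd v" "0 < w"
  obtains z where "v = w * z" "1 \<le> z" "z \<le> s div 2"
proof -
  from assms(2) obtain z where z: "v = w * z" by blast
  with assms have "z \<le> s div 2" "0 < z"
    by (auto simp: half_set_def zero_less_mult_iff)
  thus ?thesis using that z by force
qed

lemma half_set_multipleI:
  assumes "1 \<le> z" "z \<le> s div 2" "0 < w" "odd s"
  shows "w * z \<in> half_set s w"
proof -
  have "z < s" using assms by presburger
  thus ?thesis using assms by (simp add: half_set_def mult.commute)
qed

text \<open>Voltages keep residues modulo \<open>w\<close>, so \<open>h\<close> and
  \<open>h'\<close> undergo the same shift; it cancels, and both lie between \<open>0\<close> and
  \<open>s * w\<close>.\<close>

lemma voltage_inj:
  assumes h: "h \<in> half_set s w" "h' \<in> half_set s w"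
    and eq: "voltage s w b h mod (s * w) = voltage s w b h' mod (s * w)"
  shows "h = h'"
proof -
  have "h mod w = h' mod w"
    using eq by (metis voltage_mod_w dvd_triv_right mod_mod_cancel)
  hence "w dvd h \<longleftrightarrow> w dvd h'" by (simp add: dvd_eq_mod_eq_0)
  hence "shift s w h = shift s w h'" by (simp add: shift_def)
  hence "h mod (s * w) = h' mod (s * w)"
    using eq by (cases b) (auto simp: voltage_def, metis add_diff_cancel_right' mod_diff_left_eq)
  thus ?thesis using h by (auto simp: half_set_def)
qed

text \<open>Residues modulo \<open>w\<close> on the half-set are below \<open>w / 2\<close>, so two
  of them add up to a multiple of \<open>w\<close> only if both vanish. For multiples of
  \<open>w\<close>, the quotients of the voltages all lie in one half of the nonzero residues modulo
  \<open>s\<close>: the lower half without the shift, the upper half with it.\<close>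

lemma voltage_neq_uminus:
  assumes s: "odd s" "0 < s" and w: "odd w" "0 < w"
    and h: "h \<in> half_set s w" "h' \<in> half_set s w"
  shows "\<not> s * w dvd voltage s w b h + voltage s w b h'"
proof
  assume dvd: "s * w dvd voltage s w b h + voltage s w b h'"
  hence "w dvd voltage s w b h + voltage s w b h'" using dvd_mult_right by blast
  hence w_dvd: "w dvd h mod w + h' mod w"
    by (metis voltage_mod_w mod_add_eq dvd_eq_mod_eq_0)
  have res: "v mod w = 0 \<or> (1 \<le> v mod w \<and> 2 * (v mod w) < w)" if "v \<in> half_set s w" for v
    using that w by (auto simp: half_set_def elim!: oddE)
  have "h mod w = 0 \<and> h' mod w = 0"
  proof (rule ccontr)
    assume "\<not> ?thesis"
    moreover have "0 \<le> h mod w" "0 \<le> h' mod w" using w by auto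
    ultimately have "0 < h mod w + h' mod w" "h mod w + h' mod w < w"
      using res[OF h(1)] res[OF h(2)] by auto
    with w_dvd show False by (simp add: zdvd_not_zless)
  qed
  hence d: "w dvd h" "w dvd h'" by auto
  obtain z where z: "h = w * z" "1 \<le> z" "z \<le> s div 2" using half_set_multipleE[OF h(1) d(1) w(2)] .
  obtain z' where z': "h' = w * z'" "1 \<le> z'" "z' \<le> s div 2" using half_set_multipleE[OF h(2) d(2) w(2)] .
  obtain n where n: "s = 2 * n + 1" using s by (auto elim: oddE)
  show False
  proof (cases b)
    case True
    \<comment> \<open>The two shifts by \<open>w * n\<close> add \<open>2 * n = s - 1\<close> to the
      sum of the quotients.\<close>
    have "voltage s w b h + voltage s w b h' = (z + z' - 1 + s) * w"
      using True z z' n by (simp add: voltage_def shift_def algebra_simps)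
    hence "s dvd z + z' - 1 + s" using dvd w by (metis dvd_mult_cancel_right less_irrefl)
    hence "s dvd z + z' - 1" by (simp only: dvd_add_left_iff dvd_refl)
    moreover have "0 < z + z' - 1" "z + z' - 1 < s" using z z' n by auto
    ultimately show False by (simp add: zdvd_not_zless)
  next
    case False
    have "voltage s w b h + voltage s w b h' = (z + z') * w"
      using False z z' by (simp add: voltage_def algebra_simps)
    hence "s dvd z + z'" using dvd w by (metis dvd_mult_cancel_right less_irrefl)
    moreover have "0 < z + z'" "z + z' < s" using z z' n by auto
    ultimately show False by (simp add: zdvd_not_zless)
  qed
qed

text \<open>For \<open>v\<close> not divisible by \<open>w\<close>, one of \<open>v\<close> and
  \<open>- v\<close> has its residue modulo \<open>w\<close> in the lower half, and shifting by
  \<open>w\<close> permutes each such residue class. For multiples of \<open>w\<close>, the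
  quotients of the voltages fill one half of the nonzero residues modulo \<open>s\<close>.\<close>

lemma voltage_exhaust:
  assumes s: "odd s" "0 < s" and w: "odd w" "0 < w" and v: "\<not> s * w dvd v"
  shows "\<exists>h\<in>half_set s w. voltage s w b h mod (s * w) = v mod (s * w) \<or>
    voltage s w b h mod (s * w) = (- v) mod (s * w)"
proof -
  obtain n where n: "s = 2 * n + 1" using s by (auto elim: oddE)
  obtain q where q: "w = 2 * q + 1" using w by (auto elim: oddE)
  have g: "0 < s * w" using s w by simp
  have low: "\<exists>h\<in>half_set s w. voltage s w b h mod (s * w) = v mod (s * w)" if "v mod w \<in> {1..q}" for v
  proof -
    define h where "h = (v - (if b then w else 0)) mod (s * w)"
    have hw: "h mod w = v mod w" by (simp add: h_def mod_mod_cancel)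
    have "0 \<le> h" "h < s * w" using g by (auto simp: h_def)
    moreover have "h \<noteq> 0" using hw that by auto
    ultimately have "h \<in> half_set s w" using hw that q by (auto simp: half_set_def)
    moreover have "\<not> w dvd h" using hw that by (auto simp: dvd_eq_mod_eq_0)
    hence "voltage s w b h = h + (if b then w else 0)" by (simp add: voltage_def shift_def)
    hence "voltage s w b h mod (s * w) = v mod (s * w)"
      unfolding h_def by (simp add: mod_add_left_eq)
    ultimately show ?thesis by blast
  qed
  show ?thesis
  proof (cases "w dvd v")
    case False
    have nz: "v mod w \<noteq> 0" using False by (simp add: dvd_eq_mod_eq_0)
    have rng: "0 \<le> v mod w" "v mod w < w" using w by auto
    have "(- v) mod w = w - v mod w" using nz by (simp add: zmod_zminus1_eq_if)
    hence "v mod w \<in> {1..q} \<or> (- v) mod w \<in> {1..q}" using nz rng q by auto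
    thus ?thesis using low by blast
  next
    case True
    then obtain z where z: "v = w * z" by blast
    define y where "y = z mod s"
    have "y \<noteq> 0" using v z by (auto simp: y_def mult.commute)
    moreover have "0 \<le> y" "y < s" using s by (auto simp: y_def)
    ultimately have y: "1 \<le> y" "y \<le> 2 * n" using n by auto
    have vm: "v mod (s * w) = w * y" unfolding z y_def mult.commute[of s] by (rule mult_mod_right[symmetric])
    have mvm: "(- v) mod (s * w) = w * (s - y)"
    proof -
      have "0 < w * y" using y w by simp
      hence "(- v) mod (s * w) = s * w - w * y" using vm by (subst zmod_zminus1_eq_if) auto
      thus ?thesis by (simp add: algebra_simps)
    qed
    have sm: "w * a mod (s * w) = w * a" if "0 \<le> a" "a < s" for a
      unfolding mult.commute[of s] mult_mod_right[symmetric] using that by simp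
    have half: "\<exists>h\<in>half_set s w. voltage s w b h mod (s * w) = w * (if b then a + n else a)"
      if "1 \<le> a" "a \<le> n" for a
      using that half_set_multipleI[of a s w] s w n sm[of a] sm[of "a + n"]
      by (intro bexI[of _ "w * a"]) (auto simp: voltage_def shift_def simp flip: distrib_left)
    show ?thesis
    \<comment> \<open>Shifted quotients fill \<open>n + 1\<close> to \<open>2 * n\<close>, unshifted
      ones \<open>1\<close> to \<open>n\<close>. So \<open>y\<close> lies in the wrong half exactly
      when \<open>b\<close> agrees with \<open>y \<le> n\<close>, and then \<open>s - y\<close> is
      used.\<close>
    proof (cases "b = (y \<le> n)")
      case True
      have "\<exists>h\<in>half_set s w. voltage s w b h mod (s * w) = w * (s - y)"
        using half[of "if b then s - y - n else s - y"] True y n by (cases b) (simp_all add: algebra_simps)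
      thus ?thesis using mvm by auto
    next
      case False
      have "\<exists>h\<in>half_set s w. voltage s w b h mod (s * w) = w * y"
        using half[of "if b then y - n else y"] False y n by auto
      thus ?thesis using vm by auto
    qed
  qed
qed

section \<open>Lifting to the tensor product\<close>

lemma edges_tensor_complete:
  "edges (tensor_product (complete_graph u) (complete_graph g)) =
    {{(a, y), (b, z)} | a y b z. a < u \<and> b < u \<and> a \<noteq> b \<and> y < g \<and> z < g \<and> y \<noteq> z}"
proof -
  have "{a, b} \<in> edges (complete_graph n) \<longleftrightarrow> a < n \<and> b < n \<and> a \<noteq> b" for a b n
    by (auto simp: complete_graph_def doubleton_eq_iff)
  thus ?thesis by (simp add: tensor_product_def)
qed

locale lifted_factorization = near_factorization r "{..<u}" nxt fwd ty
  for r :: nat and u :: nat and nxt fwd ty +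
  fixes s w :: nat
  assumes odd_s: "odd s" and odd_w: "odd w" and k3: "3 \<le> r * s"
begin

abbreviation "H \<equiv> half_set (int s) (int w)"

definition arc_voltage :: "int \<Rightarrow> nat \<Rightarrow> nat \<Rightarrow> int" where
  "arc_voltage h a b = voltage (int s) (int w) (ty a b) h"

text \<open>The voltage belongs to the arc, so it is subtracted when the trace runs against the
  arc.\<close>

definition step_voltage :: "nat \<Rightarrow> int \<Rightarrow> nat \<Rightarrow> int" where
  "step_voltage p h a = (if fwd p a then 1 else -1) * arc_voltage h a (nxt p a)"

definition lift :: "nat \<Rightarrow> int \<Rightarrow> nat \<times> nat \<Rightarrow> nat \<times> nat" where
  "lift p h = (\<lambda>(a, y). (nxt p a, nat ((int y + step_voltage p h a) mod (int s * int w))))"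

definition factor_verts :: "nat \<Rightarrow> (nat \<times> nat) set" where
  "factor_verts p = ({..<u} - {p}) \<times> {..<s * w}"

definition factor_edges :: "nat \<Rightarrow> int \<Rightarrow> (nat \<times> nat) set set" where
  "factor_edges p h = {{x, lift p h x} | x. x \<in> factor_verts p}"

lemma pos: "0 < s" "0 < w" "0 < int s" "0 < int w" "odd (int s)" "odd (int w)"
  using odd_s odd_w by (auto intro!: Nat.gr0I)

lemma pos_g: "0 < int s * int w" "0 < s * w"
  using pos by auto

lemma arc_voltage_sym: "arc_voltage h a b = arc_voltage h b a"
  by (simp add: arc_voltage_def ty_sym)

lemma lift_in:
  assumes "p < u" "x \<in> factor_verts p"
  shows "lift p h x \<in> factor_verts p"
proof -
  obtain a y where x: "x = (a, y)" by force
  have "nat ((int y + step_voltage p h a) mod (int s * int w)) < s * w"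
    using pos_g by (simp add: nat_less_iff)
  thus ?thesis using assms nxt_in[of p a] by (auto simp: x lift_def factor_verts_def)
qed

text \<open>Otherwise twice the voltage would vanish as well, contrary to
  \<open>voltage_neq_uminus\<close> for \<open>h' = h\<close>.\<close>

lemma arc_voltage_nonzero:
  assumes "h \<in> H"
  shows "\<not> int s * int w dvd arc_voltage h a b"
  using voltage_neq_uminus[OF pos(5) pos(3) pos(6) pos(4) assms assms] dvd_add
  unfolding arc_voltage_def by blast

lemma lift_fst: "fst (lift p h (a, y)) = nxt p a"
  by (simp add: lift_def)

lemma lift_snd_mod:
  "int (snd (lift p h (a, y))) = (int y + step_voltage p h a) mod (int s * int w)"
  using pos_g by (simp add: lift_def)

lemma factor_edges_subset:
  assumes "p < u" "h \<in> H"
  shows "factor_edges p h \<subseteq> edges (tensor_product (complete_graph u) (complete_graph (s * w)))"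
proof
  fix e assume "e \<in> factor_edges p h"
  then obtain a y where e: "e = {(a, y), lift p h (a, y)}" and ay: "(a, y) \<in> factor_verts p"
    by (auto simp: factor_edges_def)
  obtain b z where bz: "lift p h (a, y) = (b, z)" by force
  have "(b, z) \<in> factor_verts p" using lift_in[OF assms(1) ay, of h] bz by simp
  moreover have "b \<noteq> a" using nxt_neq[of p a] ay assms lift_fst[of p h a y] bz by (auto simp: factor_verts_def)
  moreover have "z \<noteq> y"
  proof
    assume "z = y"
    hence "int y mod (int s * int w) = (int y + step_voltage p h a) mod (int s * int w)"
      using lift_snd_mod[of p h a y] bz by (metis mod_mod_trivial snd_conv)
    hence "int s * int w dvd step_voltage p h a"
      by (metis add_diff_cancel_left' mod_eq_dvd_iff)
    thus False using arc_voltage_nonzero[OF assms(2)] by (auto simp: step_voltage_def split: if_splits)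
  qed
  ultimately show "e \<in> edges (tensor_product (complete_graph u) (complete_graph (s * w)))"
    using ay unfolding edges_tensor_complete e bz factor_verts_def by blast
qed

section \<open>Cycle lengths in the lift\<close>

lemma lift_funpow:
  assumes c: "\<And>t. nxt p (c t) = c (Suc t)" and y: "y < s * w"
  shows "(lift p h ^^ i) (c t, y) =
    (c (t + i), nat ((int y + (\<Sum>j<i. step_voltage p h (c (t + j)))) mod (int s * int w)))"
proof (induction i)
  case 0
  have "int y mod (int s * int w) = int y" using y by (metis mod_less of_nat_mod of_nat_mult)
  thus ?case by simp
next
  case (Suc i)
  thus ?case using pos_g by (simp add: lift_def c mod_add_left_eq add.assoc)
qed

text \<open>The first coordinate returns after \<open>r * q\<close> steps only. These collect
  \<open>q\<close> times plus or minus twice the shift, which by \<open>double_shift_order\<close>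
  vanishes modulo \<open>s * w\<close> exactly when \<open>s\<close> divides
  \<open>q\<close>.\<close>

lemma lift_period:
  assumes p: "p < u" and h: "h \<in> H" and x: "x \<in> factor_verts p"
  shows "(lift p h ^^ i) x = x \<longleftrightarrow> r * s dvd i"
proof -
  obtain a y where x_eq: "x = (a, y)" by force
  with x have a: "a < u" "a \<noteq> p" and y: "y < s * w" by (auto simp: factor_verts_def)
  from cycle[of p a] a p obtain c t where
    "alternating_cycle r c ({..<u} - {p}) (nxt p) (fwd p) ty" and ct: "a = c t" by auto
  then obtain t1 t2 where nx: "\<And>t. nxt p (c t) = c (Suc t)"
    and inj: "\<And>t t'. c t = c t' \<longleftrightarrow> t mod r = t' mod r"
    and fw: "\<And>t. fwd p (c t) \<longleftrightarrow> even t"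
    and t12: "t1 < t2" "t2 < r" "even t1 = even t2"
    and ty: "\<And>t. t < r \<Longrightarrow> ty (c t) (c (Suc t)) \<longleftrightarrow> t = t1 \<or> t = t2"
    by (auto simp: alternating_cycle_def)
  define v where "v t = step_voltage p h (c t)" for t
  have v_per: "v (t + r) = v t" for t
    using inj[of "t + r" t] by (simp add: v_def)
  define d where "d = shift (int s) (int w) h"
  have "(\<Sum>j<r. v j) = (\<Sum>j<r. (if even j then 1 else -1) * (if ty (c j) (c (Suc j)) then h + d else h))"
    by (intro sum.cong) (auto simp: v_def step_voltage_def arc_voltage_def voltage_def fw nx d_def)
  also have "\<dots> = (if even t1 then 1 else -1) * (2 * d)"
    using sum_alternating[OF even_r(1) t12, of "\<lambda>t. ty (c t) (c (Suc t))" h d] ty by simp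
  finally have tot: "(\<Sum>j<r. v j) = (if even t1 then 1 else -1) * (2 * d)" .
  have iter: "(lift p h ^^ i) x = (c (t + i), nat ((int y + (\<Sum>j<i. v (t + j))) mod (int s * int w)))"
    unfolding x_eq ct v_def by (rule lift_funpow[where c = c]) (use nx y in auto)
  have "(lift p h ^^ i) x = x \<longleftrightarrow> r dvd i \<and> int s * int w dvd (\<Sum>j<i. v (t + j))"
  proof -
    have "c (t + i) = c t \<longleftrightarrow> r dvd i"
      using inj[of "t + i" t] by (metis mod_eq_dvd_iff_nat le_add1 add_diff_cancel_left')
    moreover have "nat ((int y + S) mod (int s * int w)) = y \<longleftrightarrow> int s * int w dvd S" for S
    proof -
      have "nat ((int y + S) mod (int s * int w)) = y \<longleftrightarrow> (int y + S) mod (int s * int w) = int y"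
        using pos_g by (metis int_nat_eq nat_int pos_mod_sign)
      also have "\<dots> \<longleftrightarrow> (int y + S) mod (int s * int w) = int y mod (int s * int w)"
        using y by (metis mod_less of_nat_mod of_nat_mult)
      also have "\<dots> \<longleftrightarrow> int s * int w dvd S"
        by (simp add: mod_eq_dvd_iff)
      finally show ?thesis .
    qed
    ultimately show ?thesis unfolding iter by (simp add: x_eq ct)
  qed
  also have "\<dots> \<longleftrightarrow> r * s dvd i"
  proof (cases "r dvd i")
    case True
    then obtain q where q: "i = r * q" by blast
    have "int s * int w dvd (\<Sum>j<i. v (t + j)) \<longleftrightarrow> int s * int w dvd int q * (2 * d)"
      using sum_periodic_mult[where v = v and r = r and q = q and t = t] v_per tot q by (auto simp: dvd_minus_iff)
    also have "\<dots> \<longleftrightarrow> s dvd q"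
      unfolding d_def using double_shift_order[OF pos(5) pos(3) pos(4), of "int q" h] by simp
    finally show ?thesis using True q even_r by simp
  qed (auto dest: dvd_mult_left)
  finally show ?thesis .
qed

lemma factor_edges_cycle_factor:
  assumes p: "p < u" and h: "h \<in> H"
  shows "partial_cycle_factor (r * s) u (s * w) \<lparr>verts = factor_verts p, edges = factor_edges p h\<rparr>"
proof -
  let ?F = "\<lparr>verts = factor_verts p, edges = factor_edges p h\<rparr>"
  let ?G = "tensor_product (complete_graph u) (complete_graph (s * w))"
  have sub: "e \<subseteq> factor_verts p" if "e \<in> factor_edges p h" for e
    using that lift_in[OF p] by (auto simp: factor_edges_def)
  have simple: "simple_graph ?F"
    unfolding simple_graph_def
  proof
    fix e assume e: "e \<in> edges ?F"
    with factor_edges_subset[OF p h] obtain a y b z where "e = {(a, y), (b, z)}" "a \<noteq> b"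
      by (auto simp: edges_tensor_complete)
    thus "\<exists>a\<in>verts ?F. \<exists>b\<in>verts ?F. a \<noteq> b \<and> e = {a, b}"
      using sub[of e] e by (intro bexI[of _ "(a, y)"] bexI[of _ "(b, z)"]) auto
  qed
  have verts: "verts (remove_verts ?G (partite_set (s * w) p)) = factor_verts p"
    by (auto simp: remove_verts_def induced_def tensor_product_def complete_graph_def partite_set_def factor_verts_def)
  have "verts ?G - partite_set (s * w) p = factor_verts p"
    by (auto simp: tensor_product_def complete_graph_def partite_set_def factor_verts_def)
  hence "edges ?F \<subseteq> edges (remove_verts ?G (partite_set (s * w) p))"
    using factor_edges_subset[OF p h] sub by (auto simp: remove_verts_def induced_def)
  hence "spanning_subgraph ?F (remove_verts ?G (partite_set (s * w) p))"
    using simple verts by (simp add: spanning_subgraph_def subgraph_def)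
  moreover have "\<forall>C\<in>components ?F. is_cycle_graph (r * s) C"
    using funpow_orbit_cycle_components[OF k3, of "factor_verts p" "lift p h" ?F]
      lift_in[OF p] lift_period[OF p h] by (auto simp: factor_edges_def)
  ultimately show ?thesis
    unfolding partial_cycle_factor_def using p
    by (intro bexI[of _ p]) (auto simp: complete_graph_def)
qed

section \<open>Decomposition of the edge set\<close>

text \<open>A normal form for comparing edges of different factors: read along its arc, an edge
  shows the voltage as the difference of second coordinates, in whichever direction the lift
  runs.\<close>

lemma factor_edges_orient:
  assumes p: "p < u" and h: "h \<in> H" and e: "e \<in> factor_edges p h"
  obtains a y b z q where "e = {(a, y), (b, z)}" "q < u" "q \<noteq> p"
    "(a, b) = (if fwd p q then (q, nxt p q) else (nxt p q, q))"
    "(int z - int y) mod (int s * int w) = arc_voltage h a b mod (int s * int w)"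
proof -
  from e obtain q y where e_eq: "e = {(q, y), lift p h (q, y)}" and q: "q < u" "q \<noteq> p"
    by (auto simp: factor_edges_def factor_verts_def)
  obtain b z where bz: "lift p h (q, y) = (b, z)" by force
  have b: "b = nxt p q" using lift_fst[of p h q y] bz by simp
  have zm: "int z mod (int s * int w) = (int y + step_voltage p h q) mod (int s * int w)"
    using lift_snd_mod[of p h q y] bz by simp
  show ?thesis
  proof (cases "fwd p q")
    case True
    have "(int z - int y) mod (int s * int w) = (int y + step_voltage p h q - int y) mod (int s * int w)"
      using zm by (metis mod_diff_left_eq)
    thus ?thesis using True that[of q y b z q] e_eq q b bz by (simp add: step_voltage_def)
  next
    case False
    have "(int y - int z) mod (int s * int w) = (int y - (int y + step_voltage p h q)) mod (int s * int w)"
      using zm by (metis mod_diff_right_eq)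
    thus ?thesis using False that[of b z q y q] e_eq q b bz arc_voltage_sym[of h q b]
      by (simp add: step_voltage_def insert_commute)
  qed
qed

text \<open>Two readings of an edge agree or are reversed. If they agree, the difference determines
  \<open>h\<close> and the arc determines \<open>p\<close>; if reversed, two voltages of the same
  type would sum to zero, which \<open>voltage_neq_uminus\<close> excludes.\<close>

lemma factor_edges_disjoint:
  assumes p: "p < u" "p' < u" and h: "h \<in> H" "h' \<in> H"
    and e: "e \<in> factor_edges p h" "e \<in> factor_edges p' h'"
  shows "p = p' \<and> h = h'"
proof -
  let ?g = "int s * int w"
  obtain a y b z q where 1: "e = {(a, y), (b, z)}" "q < u" "q \<noteq> p"
    "(a, b) = (if fwd p q then (q, nxt p q) else (nxt p q, q))"
    "(int z - int y) mod ?g = arc_voltage h a b mod ?g"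
    using factor_edges_orient[OF p(1) h(1) e(1)] .
  obtain a' y' b' z' q' where 2: "e = {(a', y'), (b', z')}" "q' < u" "q' \<noteq> p'"
    "(a', b') = (if fwd p' q' then (q', nxt p' q') else (nxt p' q', q'))"
    "(int z' - int y') mod ?g = arc_voltage h' a' b' mod ?g"
    using factor_edges_orient[OF p(2) h(2) e(2)] .
  from 1(1) 2(1) have "(a' = a \<and> y' = y \<and> b' = b \<and> z' = z) \<or> (a' = b \<and> y' = z \<and> b' = a \<and> z' = y)"
    by (auto simp: doubleton_eq_iff)
  thus ?thesis
  proof
    assume same: "a' = a \<and> y' = y \<and> b' = b \<and> z' = z"
    hence "h = h'"
      using 1(5) 2(5) voltage_inj[OF h] by (simp add: arc_voltage_def)
    moreover have "(p, q) = (p', q')"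
    proof (rule inj_onD[OF inj_on_arc])
      show "(case (p, q) of (p, a) \<Rightarrow> if fwd p a then (a, nxt p a) else (nxt p a, a)) =
          (case (p', q') of (p, a) \<Rightarrow> if fwd p a then (a, nxt p a) else (nxt p a, a))"
        unfolding prod.case using 1(4) 2(4) same by metis
    qed (use 1(2,3) 2(2,3) p in simp_all)
    ultimately show ?thesis by simp
  next
    assume "a' = b \<and> y' = z \<and> b' = a \<and> z' = y"
    hence "(int y - int z) mod ?g = arc_voltage h' a b mod ?g" using 2(5) arc_voltage_sym by simp
    hence "(arc_voltage h a b + arc_voltage h' a b) mod ?g = ((int z - int y) + (int y - int z)) mod ?g"
      using 1(5) by (metis mod_add_eq)
    hence "?g dvd arc_voltage h a b + arc_voltage h' a b" by (simp add: dvd_eq_mod_eq_0)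
    thus ?thesis
      using voltage_neq_uminus[OF pos(5) pos(3) pos(6) pos(4) h] unfolding arc_voltage_def by blast
  qed
qed

lemma factor_edges_of_arc:
  assumes ab: "a < u" "b < u" "a \<noteq> b" and yz: "y < s * w" "z < s * w"
    and v: "(int z - int y) mod (int s * int w) = arc_voltage h a b mod (int s * int w)"
  shows "\<exists>p<u. {(a, y), (b, z)} \<in> factor_edges p h"
proof -
  let ?g = "int s * int w"
  have red: "nat (int n mod ?g) = n" if "n < s * w" for n
    using that by (metis mod_less nat_int of_nat_mod of_nat_mult)
  from arc[of a b] ab obtain p where p: "p < u" "p \<noteq> a" "p \<noteq> b"
    "(nxt p a = b \<and> fwd p a) \<or> (nxt p b = a \<and> \<not> fwd p b)" by auto
  from p(4) have "{(a, y), (b, z)} \<in> factor_edges p h"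
  proof
    assume f: "nxt p a = b \<and> fwd p a"
    have "(int y + arc_voltage h a b) mod ?g = (int y + (int z - int y)) mod ?g"
      using v by (metis mod_add_right_eq)
    hence "lift p h (a, y) = (b, z)" using f red[OF yz(2)] by (simp add: lift_def step_voltage_def)
    moreover have "(a, y) \<in> factor_verts p" using ab p yz by (auto simp: factor_verts_def)
    ultimately show ?thesis unfolding factor_edges_def by force
  next
    assume f: "nxt p b = a \<and> \<not> fwd p b"
    have "(int z - arc_voltage h a b) mod ?g = (int z - (int z - int y)) mod ?g"
      using v by (metis mod_diff_right_eq)
    hence "lift p h (b, z) = (a, y)"
      using f red[OF yz(1)] arc_voltage_sym[of h a b] by (simp add: lift_def step_voltage_def)
    moreover have "(b, z) \<in> factor_verts p" using ab p yz by (auto simp: factor_verts_def)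
    ultimately show ?thesis 
      unfolding factor_edges_def by (intro CollectI exI[of _ "(b, z)"]) auto
  qed
  thus ?thesis using p by blast
qed

text \<open>The difference of second coordinates is a voltage up to sign; the sign decides whether
  the arc from \<open>a\<close> to \<open>b\<close> or the opposite one carries the edge.\<close>

lemma factor_edges_cover:
  assumes "e \<in> edges (tensor_product (complete_graph u) (complete_graph (s * w)))"
  shows "\<exists>p<u. \<exists>h\<in>H. e \<in> factor_edges p h"
proof -
  let ?g = "int s * int w"
  from assms obtain a y b z where e: "e = {(a, y), (b, z)}" and ab: "a < u" "b < u" "a \<noteq> b"
    and yz: "y < s * w" "z < s * w" "y \<noteq> z" by (auto simp: edges_tensor_complete)
  have "\<not> ?g dvd int z - int y"
  proof
    assume "?g dvd int z - int y"
    hence "int z mod ?g = int y mod ?g" by (simp add: mod_eq_dvd_iff)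
    thus False using yz by (metis mod_less of_nat_eq_iff of_nat_mod of_nat_mult)
  qed
  from voltage_exhaust[OF pos(5) pos(3) pos(6) pos(4) this, of "ty a b"]
  obtain h where h: "h \<in> H" "arc_voltage h a b mod ?g = (int z - int y) mod ?g \<or>
    arc_voltage h a b mod ?g = (int y - int z) mod ?g" by (auto simp: arc_voltage_def)
  from h(2) show ?thesis
  proof
    assume "arc_voltage h a b mod ?g = (int z - int y) mod ?g"
    thus ?thesis using factor_edges_of_arc[OF ab yz(1,2), of h] h(1) e by auto
  next
    assume "arc_voltage h a b mod ?g = (int y - int z) mod ?g"
    hence "\<exists>p<u. {(b, z), (a, y)} \<in> factor_edges p h"
      using ab yz by (intro factor_edges_of_arc) (auto simp: arc_voltage_sym[of h b a])
    thus ?thesis using h(1) e by (auto simp: insert_commute)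
  qed
qed

lemma factor_edges_nonempty:
  assumes "2 \<le> u" "p < u"
  shows "factor_edges p h \<noteq> {}"
proof -
  obtain a where "a < u" "a \<noteq> p"
    using that[of "if p = 0 then 1 else 0"] assms by auto
  hence "(a, 0) \<in> factor_verts p" using pos_g by (simp add: factor_verts_def)
  thus ?thesis unfolding factor_edges_def by blast
qed

theorem is_ARCS_lift:
  assumes "2 \<le> u"
  shows "is_ARCS (r * s) u (s * w) {factor_edges p h | p h. p < u \<and> h \<in> H}"
proof -
  let ?P = "{factor_edges p h | p h. p < u \<and> h \<in> H}"
  have "partition_on (edges (tensor_product (complete_graph u) (complete_graph (s * w)))) ?P"
  proof (rule partition_onI)
    show "\<Union> ?P = edges (tensor_product (complete_graph u) (complete_graph (s * w)))"
      using factor_edges_subset factor_edges_cover by fast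
    show "{} \<notin> ?P" using factor_edges_nonempty[OF assms] by auto
    show "disjnt A B" if "A \<in> ?P" "B \<in> ?P" "A \<noteq> B" for A B
      using that factor_edges_disjoint unfolding disjnt_iff by blast
  qed
  thus ?thesis unfolding is_ARCS_def using factor_edges_cycle_factor by fastforce
qed

end

section \<open>Near Hamiltonian cycles of the complete graph of order 4m + 1\<close>

text \<open>The Rosa labelling of the cycle \<open>C\<^bsub>4m\<^esub>\<close>: the labels are \<open>0..4m\<close> without \<open>3m\<close>, and the differences
  along edges, taken from the labels below \<open>2m\<close> to those above, are \<open>1..4m\<close>.\<close>

definition rosa_next :: "int \<Rightarrow> int \<Rightarrow> int" where
  "rosa_next m b = (if b < m then 4 * m - b else if b < 2 * m then 4 * m - 1 - b
     else if b = 2 * m then 0 else if b < 3 * m then 4 * m - b else 4 * m + 1 - b)"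

definition rosa_label :: "int \<Rightarrow> int \<Rightarrow> int" where
  "rosa_label m t = (if even t then t div 2 else if t < 2 * m then 4 * m - t div 2 else 4 * m - 1 - t div 2)"

lemma rosa_label_range:
  assumes "0 \<le> t" "t < 4 * m"
  shows "0 \<le> rosa_label m t" "rosa_label m t \<le> 4 * m" "rosa_label m t \<noteq> 3 * m"
    "rosa_label m t < 2 * m \<longleftrightarrow> even t"
  using assms unfolding rosa_label_def by (presburger+)

lemma rosa_label_inj:
  assumes "0 \<le> t" "t < 4 * m" "0 \<le> t'" "t' < 4 * m" "rosa_label m t = rosa_label m t'"
  shows "t = t'"
  using assms unfolding rosa_label_def by (auto split: if_splits elim!: evenE oddE)

lemma rosa_next_label:
  assumes "0 \<le> t" "t < 4 * m"
  shows "rosa_next m (rosa_label m t) = rosa_label m ((t + 1) mod (4 * m))"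
proof (cases "t = 4 * m - 1")
  \<comment> \<open>The closing edge runs from label \<open>2 * m\<close> back to label
    \<open>0\<close>.\<close>
  case True
  hence "odd t" by simp
  moreover have "t div 2 = 2 * m - 1" using True by simp
  ultimately show ?thesis using assms True by (simp add: rosa_label_def rosa_next_def)
next
  case False
  hence Suc: "(t + 1) mod (4 * m) = t + 1" using assms by simp
  show ?thesis
  proof (cases "even t")
    case True
    then obtain i where "t = 2 * i" by blast
    thus ?thesis using assms Suc by (auto simp: rosa_label_def rosa_next_def)
  next
    case odd: False
    then obtain i where "t = 2 * i + 1" by (auto elim: oddE)
    thus ?thesis using assms Suc False by (auto simp: rosa_label_def rosa_next_def)
  qed
qed

lemma rosa_label_surj:
  assumes "0 \<le> b" "b \<le> 4 * m" "b \<noteq> 3 * m"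
  shows "\<exists>t. 0 \<le> t \<and> t < 4 * m \<and> rosa_label m t = b"
proof -
  consider "b < 2 * m" | "2 * m \<le> b" "b < 3 * m" | "3 * m < b" using assms by linarith
  thus ?thesis
  proof cases
    case 1 thus ?thesis using assms by (intro exI[of _ "2 * b"]) (simp add: rosa_label_def)
  next
    case 2 thus ?thesis using assms by (intro exI[of _ "2 * (4 * m - 1 - b) + 1"]) (simp add: rosa_label_def)
  next
    case 3 thus ?thesis using assms by (intro exI[of _ "2 * (4 * m - b) + 1"]) (simp add: rosa_label_def)
  qed
qed

text \<open>Even differences \<open>2 * e\<close> come from the edges joining
  \<open>2 * m - e\<close> and \<open>2 * m + e\<close>, except that for \<open>e = m\<close>, where
  the missing label would occur, the closing edge from \<open>2 * m\<close> to \<open>0\<close>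
  steps in. Odd differences \<open>2 * e + 1\<close> come from \<open>2 * m - 1 - e\<close> and
  \<open>2 * m + e\<close> if \<open>e < m\<close>, and from \<open>2 * m - e\<close> and
  \<open>2 * m + e + 1\<close> otherwise.\<close>

lemma rosa_difference:
  assumes "1 \<le> d" "d \<le> 4 * m"
  shows "\<exists>b. 0 \<le> b \<and> b \<le> 4 * m \<and> b \<noteq> 3 * m \<and>
    (if b < 2 * m then rosa_next m b - b = d else b - rosa_next m b = d)"
proof (cases "even d")
  case True
  then obtain e where e: "d = 2 * e" by blast
  consider "e < m" | "e = m" | "m < e" by linarith
  thus ?thesis
  proof cases
    case 1 thus ?thesis using assms e by (intro exI[of _ "2 * m + e"]) (simp add: rosa_next_def)
  next
    case 2 thus ?thesis using assms e by (intro exI[of _ "2 * m"]) (simp add: rosa_next_def)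
  next
    case 3 thus ?thesis using assms e by (intro exI[of _ "2 * m - e"]) (simp add: rosa_next_def)
  qed
next
  case False
  then obtain e where e: "d = 2 * e + 1" by (auto elim: oddE)
  show ?thesis
  proof (cases "e < m")
    case True thus ?thesis using assms e by (intro exI[of _ "2 * m - 1 - e"]) (simp add: rosa_next_def)
  next
    case False thus ?thesis using assms e by (intro exI[of _ "2 * m + e + 1"]) (simp add: rosa_next_def)
  qed
qed

text \<open>Near factors of the complete graph on the residues modulo \<open>4m + 1\<close>: the translates of the
  labelled cycle. Since \<open>2m\<close> and \<open>2m + 1\<close> are opposite residues, marking the differences
  \<open>2m\<close> and \<open>2m + 1\<close> is symmetric.\<close>

definition fill_next :: "int \<Rightarrow> int \<Rightarrow> int \<Rightarrow> int" where
  "fill_next m p a = (rosa_next m ((a - p + 3 * m) mod (4 * m + 1)) + p - 3 * m) mod (4 * m + 1)"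

definition fill_fwd :: "int \<Rightarrow> int \<Rightarrow> int \<Rightarrow> bool" where
  "fill_fwd m p a \<longleftrightarrow> (a - p + 3 * m) mod (4 * m + 1) < 2 * m"

definition fill_ty :: "int \<Rightarrow> int \<Rightarrow> int \<Rightarrow> bool" where
  "fill_ty m a b \<longleftrightarrow> (a - b) mod (4 * m + 1) \<in> {2 * m, 2 * m + 1}"

lemma fill_ty_sym: "0 < m \<Longrightarrow> fill_ty m a b = fill_ty m b a"
proof -
  assume "0 < m"
  have "(b - a) mod (4 * m + 1) = (if (a - b) mod (4 * m + 1) = 0 then 0 else (4 * m + 1) - (a - b) mod (4 * m + 1))"
    using zmod_zminus1_eq_if[of "a - b" "4 * m + 1"] by simp
  thus ?thesis using \<open>0 < m\<close> by (auto simp: fill_ty_def)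
qed

text \<open>The edge at position \<open>2 * m - 1\<close> has difference \<open>2 * m + 1\<close>,
  the closing one has \<open>2 * m\<close>. Both positions are odd, which gives the equal
  orientation wanted of marked edges.\<close>

lemma rosa_marked:
  assumes "0 < m" "0 \<le> t" "t < 4 * m"
  shows "fill_ty m (rosa_label m t) (rosa_next m (rosa_label m t)) \<longleftrightarrow> t = 2 * m - 1 \<or> t = 4 * m - 1"
proof -
  let ?b = "rosa_label m t" let ?d = "?b - rosa_next m ?b"
  have m': "?d mod (4 * m + 1) = (if ?d < 0 then ?d + (4 * m + 1) else ?d)"
  proof (cases "?d < 0")
    case True
    have "?d mod (4 * m + 1) = (?d + (4 * m + 1)) mod (4 * m + 1)" by simp
    also have "\<dots> = ?d + (4 * m + 1)"
      using True rosa_label_range[OF assms(2,3)] assms by (intro mod_pos_pos_trivial) (auto simp: rosa_next_def)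
    finally show ?thesis using True by simp
  next
    case False
    thus ?thesis using rosa_label_range[OF assms(2,3)] assms by (auto simp: rosa_next_def)
  qed
  show ?thesis
  proof (cases "even t")
    case True
    then obtain i where "t = 2 * i" by blast
    thus ?thesis using assms unfolding fill_ty_def m' unfolding rosa_label_def rosa_next_def by (simp split: if_splits)
  next
    case odd: False
    then obtain i where "t = 2 * i + 1" by (auto elim: oddE)
    thus ?thesis using assms unfolding fill_ty_def m' unfolding rosa_label_def rosa_next_def by (auto split: if_splits)
  qed
qed

text \<open>The Rosa cycle is translated by \<open>p - 3 * m\<close>, which puts the missing label
  \<open>3 * m\<close> on \<open>p\<close>.\<close>

lemma fill_cycle:
  assumes "0 < m" and p: "p \<in> {0..4 * m}" and a: "a \<in> {0..4 * m}" "a \<noteq> p"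
  shows "\<exists>c. alternating_cycle (nat (4 * m)) c ({0..4 * m} - {p}) (fill_next m p) (fill_fwd m p) (fill_ty m) \<and>
    a \<in> range c"
proof -
  let ?M = "4 * m + 1"
  have red: "a mod ?M = a" if "a \<in> {0..4 * m}" for a using that by simp
  define l where "l t = rosa_label m (int (t mod nat (4 * m)))" for t
  define c where "c t = (l t + p - 3 * m) mod ?M" for t
  have tm: "0 \<le> int (t mod nat (4 * m))" "int (t mod nat (4 * m)) < 4 * m" for t
    using assms(1) by (simp, metis mod_less_divisor zero_less_nat_eq zless_nat_eq_int_zless mult_pos_pos zero_less_numeral)
  have l: "0 \<le> l t" "l t \<le> 4 * m" "l t \<noteq> 3 * m" "l t < 2 * m \<longleftrightarrow> even t" for t
  proof -
    have "even (int (t mod nat (4 * m))) \<longleftrightarrow> even t"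
      using assms(1) by (simp add: dvd_mod_iff even_nat_iff)
    thus "0 \<le> l t" "l t \<le> 4 * m" "l t \<noteq> 3 * m" "l t < 2 * m \<longleftrightarrow> even t"
      using rosa_label_range[OF tm[of t]] by (auto simp: l_def)
  qed
  have unshift: "(c t - p + 3 * m) mod ?M = l t" for t
  proof -
    have "(c t - p + 3 * m) mod ?M = (c t + (3 * m - p)) mod ?M" by (simp add: algebra_simps)
    also have "\<dots> = (l t + p - 3 * m + (3 * m - p)) mod ?M" unfolding c_def by (rule mod_add_left_eq)
    also have "\<dots> = l t" using l[of t] by simp
    finally show ?thesis .
  qed
  have l_Suc: "rosa_next m (l t) = l (Suc t)" for t
  proof -
    have "(int (t mod nat (4 * m)) + 1) mod (4 * m) = int (Suc t mod nat (4 * m))"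
      using assms(1) by (simp add: zmod_int mod_add_right_eq add.commute)
    thus ?thesis unfolding l_def using rosa_next_label[OF tm[of t]] by simp
  qed
  have c_Suc: "fill_next m p (c t) = c (Suc t)" for t
    unfolding fill_next_def unshift l_Suc by (simp add: c_def)
  have cp: "c t \<noteq> p" for t
  proof
    assume "c t = p"
    hence "l t = 3 * m mod ?M" using unshift[of t] by simp
    thus False using l[of t] assms by simp
  qed
  have c_range: "c t \<in> {0..4 * m}" for t
    using assms(1) by (simp add: c_def) (smt (verit) pos_mod_bound)
  have c_inj: "c t = c t' \<longleftrightarrow> t mod nat (4 * m) = t' mod nat (4 * m)" for t t'
  proof
    assume "c t = c t'"
    hence "l t = l t'" using unshift by metis
    thus "t mod nat (4 * m) = t' mod nat (4 * m)"
      using rosa_label_inj[OF tm[of t] tm[of t']] by (simp add: l_def)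
  qed (simp add: c_def l_def)
  have c_ty: "fill_ty m (c t) (c (Suc t)) \<longleftrightarrow> t = nat (2 * m - 1) \<or> t = nat (4 * m - 1)" if "t < nat (4 * m)" for t
  proof -
    have "(c t - c (Suc t)) mod ?M = (l t - rosa_next m (l t)) mod ?M"
      unfolding c_def l_Suc by (simp add: mod_diff_eq)
    hence "fill_ty m (c t) (c (Suc t)) = fill_ty m (l t) (rosa_next m (l t))" by (simp add: fill_ty_def)
    also have "\<dots> \<longleftrightarrow> int t = 2 * m - 1 \<or> int t = 4 * m - 1"
      using rosa_marked[OF assms(1), of "int t"] that by (simp add: l_def)
    finally show ?thesis using assms(1) by auto
  qed
  have "even (nat (2 * m - 1)) = even (nat (4 * m - 1))" using assms(1) by (simp add: even_nat_iff)
  hence "\<exists>t1 t2. t1 < t2 \<and> t2 < nat (4 * m) \<and> even t1 = even t2 \<and>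
      (\<forall>t<nat (4 * m). fill_ty m (c t) (c (Suc t)) \<longleftrightarrow> t = t1 \<or> t = t2)"
    using c_ty assms(1) by (intro exI[of _ "nat (2 * m - 1)"] exI[of _ "nat (4 * m - 1)"]) simp
  moreover have "fill_fwd m p (c t) \<longleftrightarrow> even t" for t
    by (simp add: fill_fwd_def unshift l)
  ultimately have "alternating_cycle (nat (4 * m)) c ({0..4 * m} - {p}) (fill_next m p) (fill_fwd m p) (fill_ty m)"
    unfolding alternating_cycle_def using c_range cp c_Suc c_inj by blast
  moreover have "a \<in> range c"
  proof -
    define b where "b = (a - p + 3 * m) mod ?M"
    have ab: "(b + p - 3 * m) mod ?M = a"
    proof -
      have "(b + p - 3 * m) mod ?M = (b + (p - 3 * m)) mod ?M" by (simp add: algebra_simps)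
      also have "\<dots> = (a - p + 3 * m + (p - 3 * m)) mod ?M" unfolding b_def by (rule mod_add_left_eq)
      also have "\<dots> = a" using red[OF a(1)] by simp
      finally show ?thesis .
    qed
    have "b \<noteq> 3 * m" using ab red[OF p] a by auto
    moreover have "0 \<le> b" "b \<le> 4 * m"
      using assms(1) by (simp_all add: b_def) (smt (verit) pos_mod_bound)
    ultimately obtain t where t: "0 \<le> t" "t < 4 * m" "rosa_label m t = b"
      using rosa_label_surj by blast
    hence "c (nat t) = a" using ab by (simp add: c_def l_def nat_mod_distrib)
    thus ?thesis by blast
  qed
  ultimately show ?thesis by blast
qed

text \<open>Arcs run from low labels to high ones, so every nonzero residue modulo
  \<open>4 * m + 1\<close> is the difference of an arc, and the translates of that arc run through
  all ordered pairs with this difference.\<close>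

lemma near_factorization_fill:
  assumes "0 < m"
  shows "near_factorization (nat (4 * m)) {0..4 * m} (fill_next m) (fill_fwd m) (fill_ty m)"
proof
  let ?M = "4 * m + 1"
  have red: "a mod ?M = a" if "a \<in> {0..4 * m}" for a using that by simp
  show "finite {0..4 * m}" "even (nat (4 * m))" "0 < nat (4 * m)"
    using assms by (auto simp: even_nat_iff)
  show "fill_ty m a b = fill_ty m b a" for a b using fill_ty_sym[OF assms] .
  show "\<exists>c. alternating_cycle (nat (4 * m)) c ({0..4 * m} - {p}) (fill_next m p) (fill_fwd m p) (fill_ty m) \<and> a \<in> range c"
    if "p \<in> {0..4 * m}" "a \<in> {0..4 * m}" "a \<noteq> p" for p a
    using fill_cycle[OF assms that] .
  have place: "\<exists>p\<in>{0..4 * m}. p \<noteq> v \<and> p \<noteq> fill_next m p v \<and>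
      fill_next m p v = (v + (rosa_next m z - z)) mod ?M \<and> (fill_fwd m p v \<longleftrightarrow> z < 2 * m)"
    if v: "v \<in> {0..4 * m}" and z: "0 \<le> z" "z \<le> 4 * m" "z \<noteq> 3 * m" for v z
  proof -
    \<comment> \<open>The translate in which \<open>v\<close> carries the label
      \<open>z\<close>.\<close>
    define p where "p = (v - z + 3 * m) mod ?M"
    have pm: "(v - p + 3 * m) mod ?M = z"
    proof -
      have "(v - p + 3 * m) mod ?M = (v + 3 * m - p) mod ?M" by (simp add: algebra_simps)
      also have "\<dots> = (v + 3 * m - (v - z + 3 * m)) mod ?M" unfolding p_def by (rule mod_diff_right_eq)
      also have "\<dots> = z" using z by simp
      finally show ?thesis .
    qed
    have "fill_next m p v = (rosa_next m z - 3 * m + p) mod ?M"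
      unfolding fill_next_def pm by (simp add: algebra_simps)
    also have "\<dots> = (rosa_next m z - 3 * m + (v - z + 3 * m)) mod ?M"
      unfolding p_def by (rule mod_add_right_eq)
    also have "\<dots> = (v + (rosa_next m z - z)) mod ?M" by (simp add: algebra_simps)
    finally have nx: "fill_next m p v = (v + (rosa_next m z - z)) mod ?M" .
    have pin: "p \<in> {0..4 * m}"
      using assms pos_mod_bound[of ?M "v - z + 3 * m"] by (simp add: p_def)
    have pv: "p \<noteq> v" using pm z assms by auto
    have "p \<noteq> fill_next m p v"
      using fill_cycle[OF assms pin v] pv by (auto simp: alternating_cycle_def)
    thus ?thesis using pin pv nx by (auto simp: fill_fwd_def pm)
  qed
  show "\<exists>p\<in>{0..4 * m}. p \<noteq> a \<and> p \<noteq> b \<and> (fill_next m p a = b \<and> fill_fwd m p a \<or> fill_next m p b = a \<and> \<not> fill_fwd m p b)"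
    if a: "a \<in> {0..4 * m}" and b: "b \<in> {0..4 * m}" "a \<noteq> b" for a b
  proof -
    have "(b - a) mod ?M \<noteq> 0"
      using a b red by (metis mod_0_imp_dvd mod_eq_dvd_iff)
    moreover have "0 \<le> (b - a) mod ?M" "(b - a) mod ?M < ?M"
      using assms by (auto intro: pos_mod_bound simp del: zle_add1_eq_le)
    ultimately obtain z where z: "0 \<le> z" "z \<le> 4 * m" "z \<noteq> 3 * m"
      "if z < 2 * m then rosa_next m z - z = (b - a) mod ?M else z - rosa_next m z = (b - a) mod ?M"
      using rosa_difference[of "(b - a) mod ?M" m] by auto
    show ?thesis
    proof (cases "z < 2 * m")
      case True
      hence "(a + (rosa_next m z - z)) mod ?M = b"
        using z(4) red[OF b(1)] by (simp add: mod_add_right_eq)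
      thus ?thesis using place[OF a z(1-3)] True by metis
    next
      case False
      have "(b + (rosa_next m z - z)) mod ?M = (b - (z - rosa_next m z)) mod ?M"
        by (simp add: algebra_simps)
      also have "\<dots> = a" using z(4) False red[OF a] by (simp add: mod_diff_right_eq)
      finally show ?thesis using place[OF b(1) z(1-3)] False by metis
    qed
  qed
qed

section \<open>Idempotent quasigroups\<close>

lemma mod_eq_self_iff:
  fixes n a i :: int
  assumes "0 \<le> i" "i < n"
  shows "a mod n = i \<longleftrightarrow> n dvd a - i" "i = a mod n \<longleftrightarrow> n dvd a - i"
proof -
  have "i = i mod n" using assms by simp
  thus "a mod n = i \<longleftrightarrow> n dvd a - i" by (metis mod_eq_dvd_iff)
  thus "i = a mod n \<longleftrightarrow> n dvd a - i" by metis
qed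

lemma dvd_small_eq:
  fixes n i j :: int
  assumes "0 \<le> i" "i < n" "0 \<le> j" "j < n" "n dvd i - j"
  shows "i = j"
  using assms by (metis mod_eq_dvd_iff mod_pos_pos_trivial)

text \<open>\<open>T j i\<close> is the product in an idempotent quasigroup and \<open>T' j\<close>
  inverts \<open>T j\<close>. Only entries with \<open>i \<noteq> j\<close> are recorded, since
  group \<open>j\<close> is filled separately; idempotency appears as \<open>T j i\<close> differing
  from both \<open>j\<close> and \<open>i\<close>.\<close>

definition idempotent_action :: "int \<Rightarrow> (int \<Rightarrow> int \<Rightarrow> int) \<Rightarrow> (int \<Rightarrow> int \<Rightarrow> int) \<Rightarrow> bool" where
  "idempotent_action x T T' \<longleftrightarrow>
     (\<forall>j\<in>{0..<x}. \<forall>i\<in>{0..<x} - {j}. T j i \<in> {0..<x} - {j} \<and> T' j i \<in> {0..<x} - {j} \<and>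
        T j i \<noteq> i \<and> T' j (T j i) = i \<and> T j (T' j i) = i) \<and>
     (\<forall>i\<in>{0..<x}. \<forall>k\<in>{0..<x}. i \<noteq> k \<longrightarrow> (\<exists>j\<in>{0..<x}. j \<noteq> i \<and> j \<noteq> k \<and> T j i = k))"

lemma idempotent_action_odd:
  assumes x: "odd x" "0 < x"
  shows "idempotent_action x (\<lambda>j i. (2 * j - i) mod x) (\<lambda>j i. (2 * j - i) mod x)"
proof -
  have cop: "coprime x 2" using x by (simp add: coprime_right_2_iff_odd)
  have 1: "(2 * j - i) mod x \<in> {0..<x} - {j} \<and> (2 * j - i) mod x \<noteq> i \<and> (2 * j - (2 * j - i) mod x) mod x = i"
    if "j \<in> {0..<x}" "i \<in> {0..<x} - {j}" for i j
  proof -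
    have ne: "\<not> x dvd j - i" using that dvd_small_eq[of j x i] by auto
    have "(2 * j - i) mod x \<noteq> j" using that ne by (subst mod_eq_self_iff) auto
    moreover have "(2 * j - i) mod x \<noteq> i"
    proof
      assume "(2 * j - i) mod x = i"
      hence "x dvd (j - i) * 2" using that by (simp add: mod_eq_self_iff algebra_simps)
      thus False using ne coprime_dvd_mult_left_iff[OF cop] by blast
    qed
    moreover have "(2 * j - (2 * j - i) mod x) mod x = i"
      using that by (simp add: mod_diff_right_eq)
    ultimately show ?thesis using x by simp
  qed
  have 2: "\<exists>j\<in>{0..<x}. j \<noteq> i \<and> j \<noteq> k \<and> (2 * j - i) mod x = k"
    if ik: "i \<in> {0..<x}" "k \<in> {0..<x}" "i \<noteq> k" for i k
  proof -
    obtain n where n: "x = 2 * n + 1" using x by (auto elim: oddE)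
    \<comment> \<open>\<open>n + 1\<close> is the inverse of \<open>2\<close> modulo
      \<open>x\<close>, so \<open>j\<close> is the midpoint of \<open>i\<close> and
      \<open>k\<close>, and reflection in \<open>j\<close> exchanges them.\<close>
    define j where "j = ((i + k) * (n + 1)) mod x"
    have "2 * j mod x = (2 * ((i + k) * (n + 1))) mod x" unfolding j_def by (rule mod_mult_right_eq)
    also have "2 * ((i + k) * (n + 1)) = (i + k) + (i + k) * x" by (simp add: n algebra_simps)
    finally have "2 * j mod x = (i + k) mod x" by simp
    hence d: "x dvd 2 * j - (i + k)" by (simp add: mod_eq_dvd_iff)
    have "(2 * j - i) mod x = k"
      using ik d by (subst mod_eq_self_iff) (auto simp: algebra_simps)
    moreover have "j \<in> {0..<x}" using x by (simp add: j_def)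
    moreover have "j \<noteq> i" using d ik dvd_small_eq[of i x k] by auto
    moreover have "j \<noteq> k" using d ik dvd_small_eq[of k x i] by auto
    ultimately show ?thesis by blast
  qed
  show ?thesis unfolding idempotent_action_def using 1 2 by blast
qed

text \<open>The prolongation of \<open>T j i = 2j - i\<close> along the transversal \<open>T j i = i + 1\<close>, the new element
  being \<open>n\<close>.  With \<open>\<eta>\<close> an inverse of \<open>2\<close>, the inverse of the action is obtained by negating \<open>\<eta>\<close>.\<close>

definition prolonged_action :: "int \<Rightarrow> int \<Rightarrow> int \<Rightarrow> int \<Rightarrow> int" where
  "prolonged_action n \<eta> j i = (if j = n then (i + 2 * \<eta>) mod n else if i = n then (j + \<eta>) mod n
     else if i = (j - \<eta>) mod n then n else (2 * j - i) mod n)"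

text \<open>Stated for every \<open>\<eta>\<close> not divisible by \<open>n\<close>, so that it
  covers \<open>- \<eta>\<close> and with it the inverse action.\<close>

lemma prolonged_action_range:
  assumes n: "odd n" "0 < n" and \<eta>: "\<not> n dvd \<eta>"
    and ji: "j \<in> {0..<n + 1}" "i \<in> {0..<n + 1} - {j}"
  shows "prolonged_action n \<eta> j i \<in> {0..<n + 1} - {j}" "prolonged_action n \<eta> j i \<noteq> i"
proof -
  have cop: "coprime n 2" using n by (simp add: coprime_right_2_iff_odd)
  have \<eta>2: "\<not> n dvd 2 * \<eta>" using \<eta> cop by (simp add: coprime_dvd_mult_right_iff)
  have bnd: "0 \<le> a mod n" "a mod n \<le> n" "a mod n \<noteq> n" for a
    using pos_mod_bound[OF n(2), of a] pos_mod_sign[OF n(2), of a] by linarith+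
  have "prolonged_action n \<eta> j i \<in> {0..<n + 1} - {j} \<and> prolonged_action n \<eta> j i \<noteq> i"
  proof (cases "j = n")
    case True
    have "(i + 2 * \<eta>) mod n \<noteq> i" using ji True \<eta>2 by (subst mod_eq_self_iff) auto
    thus ?thesis using True bnd[of "i + 2 * \<eta>"] ji by (simp add: prolonged_action_def)
  next
    case j: False
    show ?thesis
    proof (cases "i = n")
      case True
      have "(j + \<eta>) mod n \<noteq> j" using ji j \<eta> by (subst mod_eq_self_iff) auto
      thus ?thesis using True j bnd[of "j + \<eta>"] by (simp add: prolonged_action_def)
    next
      case i: False
      have ne: "\<not> n dvd j - i" using ji i j dvd_small_eq[of j n i] by auto
      have "(2 * j - i) mod n \<noteq> j" using ji i j ne by (subst mod_eq_self_iff) auto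
      moreover have "(2 * j - i) mod n \<noteq> i"
      proof
        assume "(2 * j - i) mod n = i"
        hence "n dvd (j - i) * 2" using ji i j by (simp add: mod_eq_self_iff algebra_simps)
        thus False using ne coprime_dvd_mult_left_iff[OF cop] by blast
      qed
      ultimately show ?thesis using i j n bnd[of "2 * j - i"] by (simp add: prolonged_action_def)
    qed
  qed
  thus "prolonged_action n \<eta> j i \<in> {0..<n + 1} - {j}" "prolonged_action n \<eta> j i \<noteq> i" by auto
qed

text \<open>For \<open>j = n\<close> the sign reverses a translation. Otherwise it exchanges the
  point sent to \<open>n\<close> with the image of \<open>n\<close>, and elsewhere the reflection is
  its own inverse.\<close>

lemma prolonged_action_inverse:
  assumes n: "0 < n" and ji: "j \<in> {0..<n + 1}" "i \<in> {0..<n + 1} - {j}"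
  shows "prolonged_action n (- \<eta>) j (prolonged_action n \<eta> j i) = i"
proof -
  have bnd: "0 \<le> a mod n" "a mod n < n" "a mod n \<noteq> n" for a
    using pos_mod_bound[OF n, of a] pos_mod_sign[OF n, of a] by linarith+
  show ?thesis
  proof (cases "j = n")
    case True
    have "((i + 2 * \<eta>) mod n - 2 * \<eta>) mod n = i" using ji True by (simp add: mod_diff_left_eq)
    thus ?thesis using True by (simp add: prolonged_action_def)
  next
    case j: False
    consider "i = n" | "i \<noteq> n" "i = (j - \<eta>) mod n" | "i \<noteq> n" "i \<noteq> (j - \<eta>) mod n" by blast
    thus ?thesis
    proof cases
      case 3
      have "(2 * j - i) mod n \<noteq> (j + \<eta>) mod n"
      proof
        assume "(2 * j - i) mod n = (j + \<eta>) mod n"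
        hence "n dvd j - \<eta> - i" by (simp add: mod_eq_dvd_iff algebra_simps)
        thus False using 3 ji by (simp add: mod_eq_self_iff)
      qed
      moreover have "(2 * j - (2 * j - i) mod n) mod n = i" using 3 ji by (simp add: mod_diff_right_eq)
      ultimately show ?thesis using 3 j bnd(3) by (simp add: prolonged_action_def)
    qed (use j bnd(3) in \<open>auto simp: prolonged_action_def\<close>)
  qed
qed

lemma idempotent_action_even:
  assumes n: "odd n" "3 \<le> n"
  shows "idempotent_action (n + 1) (prolonged_action n ((n + 1) div 2)) (prolonged_action n (- ((n + 1) div 2)))"
proof -
  define \<eta> where "\<eta> = (n + 1) div 2"
  have n0: "0 < n" using n by simp
  have cop: "coprime n 2" using n by (simp add: coprime_right_2_iff_odd)
  have \<eta>2: "2 * \<eta> = n + 1" using n unfolding \<eta>_def by presburger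
  have \<eta>: "\<not> n dvd \<eta>" using \<eta>2 n by (intro zdvd_not_zless) auto
  have \<eta>': "\<not> n dvd - \<eta>" using \<eta> by simp
  have surj: "\<exists>j\<in>{0..<n + 1}. j \<noteq> i \<and> j \<noteq> k \<and> prolonged_action n \<eta> j i = k"
    if ik: "i \<in> {0..<n + 1}" "k \<in> {0..<n + 1}" "i \<noteq> k" for i k
  proof -
    have bnd: "0 \<le> a mod n" "a mod n < n" "a mod n < n + 1" "a mod n \<noteq> n" for a
      using pos_mod_bound[OF n0, of a] pos_mod_sign[OF n0, of a] by linarith+
    \<comment> \<open>If \<open>i\<close> or \<open>k\<close> is the new element, \<open>j\<close>
      is read off the transversal. A pair with \<open>k = i + 2 * \<eta>\<close> modulo
      \<open>n\<close> belongs to \<open>j = n\<close>; every other pair keeps its midpoint, which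
      is off the transversal.\<close>
    consider "i = n" | "k = n" "i \<noteq> n" | "i \<noteq> n" "k \<noteq> n" "k = (i + 2 * \<eta>) mod n" | "i \<noteq> n" "k \<noteq> n" "k \<noteq> (i + 2 * \<eta>) mod n"
      by blast
    thus ?thesis
    proof cases
      case 1
      have "((k - \<eta>) mod n + \<eta>) mod n = k" using 1 ik by (simp add: mod_add_left_eq)
      moreover have "(k - \<eta>) mod n \<noteq> k" using 1 ik \<eta> by (subst mod_eq_self_iff) auto
      ultimately show ?thesis using 1 bnd by (intro bexI[of _ "(k - \<eta>) mod n"]) (auto simp: prolonged_action_def)
    next
      case 2
      have "((i + \<eta>) mod n - \<eta>) mod n = i" using 2 ik by (simp add: mod_diff_left_eq)
      moreover have "(i + \<eta>) mod n \<noteq> i" using 2 ik \<eta> by (subst mod_eq_self_iff) auto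
      ultimately show ?thesis using 2 bnd by (intro bexI[of _ "(i + \<eta>) mod n"]) (auto simp: prolonged_action_def)
    next
      case 3
      thus ?thesis using n by (intro bexI[of _ n]) (auto simp: prolonged_action_def)
    next
      case 4
      define j where "j = ((i + k) * \<eta>) mod n"
      have "2 * j mod n = (2 * ((i + k) * \<eta>)) mod n" unfolding j_def by (rule mod_mult_right_eq)
      also have "2 * ((i + k) * \<eta>) = (i + k) * (2 * \<eta>)" by simp
      also have "\<dots> = (i + k) + (i + k) * n" unfolding \<eta>2 by (simp add: algebra_simps)
      finally have "2 * j mod n = (i + k) mod n" by simp
      hence d: "n dvd 2 * j - (i + k)" by (simp add: mod_eq_dvd_iff)
      have nk: "(2 * j - i) mod n = k" using 4 ik d by (subst mod_eq_self_iff) (auto simp: algebra_simps)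
      have "i \<noteq> (j - \<eta>) mod n"
      proof
        assume "i = (j - \<eta>) mod n"
        hence "n dvd j - \<eta> - i" using 4 ik by (simp add: mod_eq_self_iff)
        hence "n dvd (2 * j - (i + k)) - 2 * (j - \<eta> - i)" using dvd_diff[OF d dvd_mult[of n _ 2]] by blast
        hence "n dvd i + 2 * \<eta> - k" by (simp add: algebra_simps)
        thus False using 4 ik by (simp add: mod_eq_self_iff)
      qed
      hence "prolonged_action n \<eta> j i = k" using 4 nk bnd(4) by (simp add: prolonged_action_def j_def)
      moreover have "j \<noteq> i" using d ik 4 dvd_small_eq[of i n k] by auto
      moreover have "j \<noteq> k" using d ik 4 dvd_small_eq[of k n i] by auto
      moreover have "j \<in> {0..<n + 1}" using bnd by (simp add: j_def)
      ultimately show ?thesis by blast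
    qed
  qed
  have inv: "prolonged_action n \<eta> j (prolonged_action n (- \<eta>) j i) = i"
    if "j \<in> {0..<n + 1}" "i \<in> {0..<n + 1} - {j}" for i j
    using prolonged_action_inverse[OF n0 that, of "- \<eta>"] by simp
  show ?thesis
    unfolding idempotent_action_def \<eta>_def[symmetric]
    by (intro conjI ballI impI)
      (fact prolonged_action_range[OF n(1) n0 \<eta>] prolonged_action_range(1)[OF n(1) n0 \<eta>']
        prolonged_action_inverse[OF n0, where \<eta> = \<eta>] inv surj)+
qed

lemma ex_idempotent_action:
  assumes "0 < x" "x \<noteq> 2"
  shows "\<exists>T T'. idempotent_action x T T'"
proof (cases "odd x")
  case False
  hence "odd (x - 1)" "3 \<le> x - 1" using assms by presburger+
  from idempotent_action_even[OF this] show ?thesis by auto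
qed (use assms idempotent_action_odd in blast)

section \<open>Colouring a permutation\<close>

text \<open>Greedy colouring: a new point \<open>v\<close> has at most the two neighbours
  \<open>f v\<close> and \<open>f' v\<close>, so one of three colours is free. The guard
  \<open>f i \<in> S\<close> makes the induction possible, as its intermediate sets need not be
  closed under \<open>f\<close>.\<close>

lemma ex_three_colouring:
  fixes f f' :: "'a \<Rightarrow> 'a"
  assumes "finite S" and f: "\<And>i. i \<in> S \<Longrightarrow> f i \<noteq> i" "\<And>i. i \<in> S \<Longrightarrow> f' (f i) = i"
  shows "\<exists>col :: 'a \<Rightarrow> nat. (\<forall>i. col i < 3) \<and> (\<forall>i\<in>S. f i \<in> S \<longrightarrow> col i \<noteq> col (f i))"
  using assms
proof (induction S)
  case empty
  show ?case by (intro exI[of _ "\<lambda>_. 0"]) simp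
next
  case (insert v S)
  then obtain col :: "'a \<Rightarrow> nat" where col: "\<forall>i. col i < 3" "\<forall>i\<in>S. f i \<in> S \<longrightarrow> col i \<noteq> col (f i)" by auto
  obtain q :: nat where q: "q < 3" "q \<noteq> col (f v)" "q \<noteq> col (f' v)"
  proof -
    have "card ({..<3::nat} - {col (f v), col (f' v)}) > 0"
      by (rule less_le_trans[OF _ diff_card_le_card_Diff]) (auto simp: card_insert_if)
    thus ?thesis using that by (auto simp: card_gt_0_iff)
  qed
  have "(col(v := q)) i \<noteq> (col(v := q)) (f i)" if i: "i \<in> insert v S" "f i \<in> insert v S" for i
  proof (cases "i = v")
    case True thus ?thesis using q insert.prems(1)[of v] by auto
  next
    case False
    show ?thesis
    proof (cases "f i = v")
      case True
      hence "i = f' v" using insert.prems(2)[OF i(1)] by simp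
      thus ?thesis using True False q by auto
    qed (use False i col in auto)
  qed
  thus ?case using col q by (intro exI[of _ "col(v := q)"]) auto
qed

section \<open>Filling the groups of a frame\<close>


text \<open>The three non-zero linear functionals on the plane over the field with two elements, a vector
  of which is written as a number below \<open>4\<close>.  Any two of them are independent.\<close>

definition functional :: "nat \<Rightarrow> int \<Rightarrow> int" where
  "functional q f = (if q = 0 then f mod 2 else if q = 1 then f div 2 else (f mod 2 + f div 2) mod 2)"

lemma functional_range: "f \<in> {0..<4} \<Longrightarrow> functional q f = 0 \<or> functional q f = 1"
  unfolding functional_def by auto

lemma functionals_independent:
  assumes "q < 3" "q' < 3" "q \<noteq> q'" "a = 0 \<or> a = 1" "b = 0 \<or> b = 1"
  shows "\<exists>f\<in>{0..<4}. functional q f = a \<and> functional q' f = b"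
proof -
  have "{0..<4} = {0, 1, 2, 3 :: int}" by auto
  moreover have "q = 0 \<or> q = 1 \<or> q = 2" "q' = 0 \<or> q' = 1 \<or> q' = 2" using assms by auto
  ultimately show ?thesis using assms(3-5) by (auto simp: functional_def)
qed

locale frame =
  fixes m x :: int and T T' :: "int \<Rightarrow> int \<Rightarrow> int" and col :: "int \<Rightarrow> int \<Rightarrow> nat"
  assumes m_pos: "0 < m"
    and T: "idempotent_action x T T'"
    and col_less: "\<And>j i. col j i < 3"
    and col_neq: "\<And>j i. j \<in> {0..<x} \<Longrightarrow> i \<in> {0..<x} - {j} \<Longrightarrow> col j i \<noteq> col j (T j i)"
begin

definition V :: "(int \<times> int) option set" where
  "V = insert None (Some ` ({0..<x} \<times> {0..<4 * m}))"

text \<open>Group \<open>j\<close> with the infinite point \<open>None\<close> is identified with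
  the residues modulo \<open>4 * m + 1\<close>, \<open>4 * m\<close> standing for
  \<open>None\<close>.\<close>

definition point :: "int \<Rightarrow> int \<Rightarrow> (int \<times> int) option" where
  "point j l = (if l = 4 * m then None else Some (j, l))"

text \<open>The half of group \<open>i\<close> that is joined to group \<open>T j i\<close>; the
  other half is joined to \<open>T' j i\<close>. As \<open>c mod 4\<close> varies, two differently
  coloured groups show all four combinations of halves.\<close>

definition half :: "int \<Rightarrow> int \<Rightarrow> int \<Rightarrow> int" where
  "half j c i = functional (col j i) (c mod 4)"

text \<open>With \<open>e = c div 4\<close>, the step forward sends \<open>d\<close> to
  \<open>2 * e - d\<close> and the step back sends this to \<open>d + 1\<close>, modulo
  \<open>2 * m\<close>. Two steps advance by one, so the trace is a Hamiltonian cycle between the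
  two halves.\<close>

definition frame_next :: "int \<Rightarrow> int \<Rightarrow> int \<Rightarrow> int \<Rightarrow> int \<times> int" where
  "frame_next j c i d =
     (if d div (2 * m) = half j c i
      then (T j i, (1 - half j c (T j i)) * (2 * m) + (2 * (c div 4) - d) mod (2 * m))
      else (T' j i, half j c (T' j i) * (2 * m) + (2 * (c div 4) - d + 1) mod (2 * m)))"

fun nxt :: "(int \<times> int) option \<Rightarrow> (int \<times> int) option \<Rightarrow> (int \<times> int) option" where
  "nxt None None = None"
| "nxt None (Some (i, d)) = point i (fill_next m (4 * m) d)"
| "nxt (Some (j, c)) None = point j (fill_next m c (4 * m))"
| "nxt (Some (j, c)) (Some (i, d)) = (if i = j then point j (fill_next m c d) else Some (frame_next j c i d))"

fun fwd :: "(int \<times> int) option \<Rightarrow> (int \<times> int) option \<Rightarrow> bool" where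
  "fwd None None = False"
| "fwd None (Some (i, d)) = fill_fwd m (4 * m) d"
| "fwd (Some (j, c)) None = fill_fwd m c (4 * m)"
| "fwd (Some (j, c)) (Some (i, d)) = (if i = j then fill_fwd m c d else d div (2 * m) = half j c i)"

text \<open>The clause for \<open>None None\<close> lets \<open>ty_point\<close> hold without side
  conditions. Between groups the marking is symmetric and meets each cycle in two forward edges and
  no backward one.\<close>

fun ty :: "(int \<times> int) option \<Rightarrow> (int \<times> int) option \<Rightarrow> bool" where
  "ty None None = fill_ty m (4 * m) (4 * m)"
| "ty None (Some (i, d)) = fill_ty m (4 * m) d"
| "ty (Some (j, c)) None = fill_ty m c (4 * m)"
| "ty (Some (j, c)) (Some (i, d)) = (if i = j then fill_ty m c d else c mod (2 * m) = d mod (2 * m))"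

lemma T_in: "j \<in> {0..<x} \<Longrightarrow> i \<in> {0..<x} - {j} \<Longrightarrow> T j i \<in> {0..<x} - {j}"
  and T'_in: "j \<in> {0..<x} \<Longrightarrow> i \<in> {0..<x} - {j} \<Longrightarrow> T' j i \<in> {0..<x} - {j}"
  and T_neq: "j \<in> {0..<x} \<Longrightarrow> i \<in> {0..<x} - {j} \<Longrightarrow> T j i \<noteq> i"
  and T'_T: "j \<in> {0..<x} \<Longrightarrow> i \<in> {0..<x} - {j} \<Longrightarrow> T' j (T j i) = i"
  and T_T': "j \<in> {0..<x} \<Longrightarrow> i \<in> {0..<x} - {j} \<Longrightarrow> T j (T' j i) = i"
  using T unfolding idempotent_action_def by blast+

lemma T_surj:
  "i \<in> {0..<x} \<Longrightarrow> k \<in> {0..<x} \<Longrightarrow> i \<noteq> k \<Longrightarrow> \<exists>j\<in>{0..<x}. j \<noteq> i \<and> j \<noteq> k \<and> T j i = k"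
  using T unfolding idempotent_action_def by blast

lemma half_range: "half j c i = 0 \<or> half j c i = 1"
  unfolding half_def by (rule functional_range) simp

lemma point_simps:
  assumes "l \<noteq> l'"
  shows "nxt (point j l) (point j l') = point j (fill_next m l l')"
    "fwd (point j l) (point j l') = fill_fwd m l l'"
  using assms by (auto simp: point_def)

lemma ty_point: "ty (point j l) (point j l') = fill_ty m l l'"
  by (auto simp: point_def)

lemma point_eq_iff: "point j l = point j l' \<longleftrightarrow> l = l'"
  by (auto simp: point_def)

lemma point_in_V: "j \<in> {0..<x} \<Longrightarrow> l \<in> {0..4 * m} \<Longrightarrow> point j l \<in> V"
  by (auto simp: point_def V_def)

lemma ty_sym: "ty a b = ty b a"
  by (induction a b rule: ty.induct) (auto simp: fill_ty_sym[OF m_pos])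

lemma same_group_or_frame:
  assumes "0 < x" "a \<in> V" "b \<in> V"
  obtains (group) j l l' where "j \<in> {0..<x}" "l \<in> {0..4 * m}" "l' \<in> {0..4 * m}" "a = point j l" "b = point j l'"
  | (frame) j c i d where "a = Some (j, c)" "b = Some (i, d)" "i \<noteq> j" "j \<in> {0..<x}" "i \<in> {0..<x}"
      "c \<in> {0..<4 * m}" "d \<in> {0..<4 * m}"
proof -
  have some: "Some (j, c) = point j c" if "c \<in> {0..<4 * m}" for j c using that by (auto simp: point_def)
  have none: "None = point j (4 * m)" for j by (simp add: point_def)
  consider "a = None" "b = None" | j c where "a = None" "b = Some (j, c)" | j c where "a = Some (j, c)" "b = None"
    | j c i d where "a = Some (j, c)" "b = Some (i, d)" by (cases a; cases b) auto
  thus ?thesis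
  proof cases
    case 1 show ?thesis using group[of 0 "4 * m" "4 * m"] 1 none assms(1) m_pos by auto
  next
    case 2 show ?thesis using group[of j "4 * m" c] 2 none some[of c j] assms m_pos by (auto simp: V_def)
  next
    case 3 show ?thesis using group[of j c "4 * m"] 3 none some[of c j] assms m_pos by (auto simp: V_def)
  next
    case 4
    show ?thesis
    proof (cases "i = j")
      case True thus ?thesis using group[of j c d] 4 some[of c j] some[of d j] assms by (auto simp: V_def)
    next
      case False thus ?thesis using frame[of j c i d] 4 assms by (auto simp: V_def)
    qed
  qed
qed

lemma div_2m:
  assumes "v \<in> {0..<4 * m}"
  shows "v div (2 * m) = 0 \<or> v div (2 * m) = 1"
proof (cases "v < 2 * m")
  case False
  thus ?thesis using assms by (simp add: div_pos_geq)
qed (use assms in simp)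

lemma mod_4m_iff: "t mod nat (4 * m) = t' mod nat (4 * m) \<longleftrightarrow>
  even t = even t' \<and> int (t div 2) mod (2 * m) = int (t' div 2) mod (2 * m)"
proof -
  have N: "nat (4 * m) = 2 * nat (2 * m)" using m_pos by simp
  have parity: "2 * p + t mod 2 = 2 * q + t' mod 2 \<longleftrightarrow> even t = even t' \<and> p = q" for p q by presburger
  have "t mod (2 * n) = 2 * (t div 2 mod n) + t mod 2" for t n :: nat by (rule mod_mult2_eq)
  hence "t mod nat (4 * m) = t' mod nat (4 * m) \<longleftrightarrow>
      2 * (t div 2 mod nat (2 * m)) + t mod 2 = 2 * (t' div 2 mod nat (2 * m)) + t' mod 2"
    unfolding N by simp
  also have "\<dots> \<longleftrightarrow> even t = even t' \<and> t div 2 mod nat (2 * m) = t' div 2 mod nat (2 * m)"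
    by (rule parity)
  also have "t div 2 mod nat (2 * m) = t' div 2 mod nat (2 * m) \<longleftrightarrow>
      int (t div 2) mod (2 * m) = int (t' div 2) mod (2 * m)"
  proof -
    have "int (a mod nat (2 * m)) = int a mod (2 * m)" for a using m_pos by (subst of_nat_mod) simp
    thus ?thesis by (metis of_nat_eq_iff)
  qed
  finally show ?thesis .
qed

lemma frame_cycle:
  assumes j: "j \<in> {0..<x}" and c: "c \<in> {0..<4 * m}" and i: "i \<in> {0..<x}" "i \<noteq> j" and d: "d \<in> {0..<4 * m}"
  shows "\<exists>y. alternating_cycle (nat (4 * m)) y (V - {Some (j, c)}) (nxt (Some (j, c))) (fwd (Some (j, c))) ty \<and>
    Some (i, d) \<in> range y"
proof -
  let ?M = "2 * m"
  define e where "e = c div 4"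
  \<comment> \<open>The group at the even positions: \<open>i\<close> itself if \<open>d\<close>
    lies in its forward half, and otherwise the group joined to the other half of
    \<open>i\<close>.\<close>
  define i0 where "i0 = (if d div ?M = half j c i then i else T' j i)"
  define k where "k = T j i0"
  have i0: "i0 \<in> {0..<x} - {j}" using i T'_in[OF j, of i] by (auto simp: i0_def)
  have k: "k \<in> {0..<x} - {j}" "k \<noteq> i0" "T' j k = i0"
    using T_in[OF j i0] T_neq[OF j i0] T'_T[OF j i0] by (auto simp: k_def)
  have e: "0 \<le> e" "e < m" using c by (auto simp: e_def)
  define dl where "dl t = half j c i0 * ?M + int (t div 2) mod ?M" for t :: nat
  define dr where "dr t = (1 - half j c k) * ?M + (2 * e - int (t div 2)) mod ?M" for t :: nat
  define y where "y t = (if even t then Some (i0, dl t) else Some (k, dr t))" for t :: nat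
  have M: "0 < ?M" using m_pos by simp
  have bnd: "0 \<le> a mod ?M" "a mod ?M < ?M" for a using M by (auto intro: pos_mod_bound)
  have dldiv: "dl t div ?M = half j c i0" "dr t div ?M = 1 - half j c k" for t
    using M bnd by (simp_all add: dl_def dr_def div_add1_eq)
  have dlmod: "dl t mod ?M = int (t div 2) mod ?M" "dr t mod ?M = (2 * e - int (t div 2)) mod ?M" for t
    by (simp_all add: dl_def dr_def)
  have range4: "a * ?M + b mod ?M \<in> {0..<4 * m}" if "a = 0 \<or> a = 1" for a b
    using that bnd[of b] by auto
  have hk01: "1 - half j c k = 0 \<or> 1 - half j c k = 1" using half_range[of j c k] by auto
  have dlr: "dl t \<in> {0..<4 * m}" "dr t \<in> {0..<4 * m}" for t
    unfolding dl_def dr_def by (rule range4[OF half_range] range4[OF hk01])+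
  have y_in: "y t \<in> V - {Some (j, c)}" for t
    using i0 k dlr[of t] by (auto simp: y_def V_def)
  have y_fwd: "fwd (Some (j, c)) (y t) \<longleftrightarrow> even t" for t
    using i0 k half_range[of j c k] dldiv[of t] by (auto simp: y_def)
  have y_Suc: "nxt (Some (j, c)) (y t) = y (Suc t)" for t
  proof (cases "even t")
    case True
    have "(2 * e - dl t) mod ?M = (2 * e - int (t div 2)) mod ?M"
      by (metis dlmod(1) mod_diff_right_eq)
    thus ?thesis using True i0 dldiv[of t] by (simp add: y_def frame_next_def dr_def k_def e_def)
  next
    case False
    have "(2 * e - dr t + 1) mod ?M = (2 * e + 1 - dr t) mod ?M" by (simp add: algebra_simps)
    also have "\<dots> = (2 * e + 1 - (2 * e - int (t div 2))) mod ?M" by (metis dlmod(2) mod_diff_right_eq)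
    also have "\<dots> = int (Suc t div 2) mod ?M" using False by (simp add: add.commute)
    finally have "(2 * e - dr t + 1) mod ?M = int (Suc t div 2) mod ?M" .
    moreover have "dr t div ?M \<noteq> half j c k" using dldiv[of t] half_range[of j c k] by auto
    ultimately show ?thesis using False k dldiv[of t] by (simp add: y_def frame_next_def dl_def e_def)
  qed
  have y_inj: "y t = y t' \<longleftrightarrow> t mod nat (4 * m) = t' mod nat (4 * m)" for t t'
  proof -
    have "dl t = dl t' \<longleftrightarrow> int (t div 2) mod ?M = int (t' div 2) mod ?M" by (simp add: dl_def)
    moreover have "dr t = dr t' \<longleftrightarrow> int (t div 2) mod ?M = int (t' div 2) mod ?M"
    proof -
      have "dr t = dr t' \<longleftrightarrow> ?M dvd (2 * e - int (t div 2)) - (2 * e - int (t' div 2))"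
        by (simp add: dr_def mod_eq_dvd_iff)
      also have "(2 * e - int (t div 2)) - (2 * e - int (t' div 2)) = int (t' div 2) - int (t div 2)" by simp
      also have "?M dvd \<dots> \<longleftrightarrow> int (t div 2) mod ?M = int (t' div 2) mod ?M" by (metis mod_eq_dvd_iff)
      finally show ?thesis .
    qed
    ultimately show ?thesis unfolding mod_4m_iff using k(2) by (auto simp: y_def)
  qed
  \<comment> \<open>At even positions \<open>t = 2 * n\<close> the marking says that
    \<open>2 * m\<close> divides \<open>2 * (n - e)\<close>, so \<open>n\<close> is \<open>e\<close>
    or \<open>e + m\<close>; at odd positions \<open>2 * m\<close> would have to divide an odd
    number.\<close>
  have y_ty: "ty (y t) (y (Suc t)) \<longleftrightarrow> t = nat (2 * e) \<or> t = nat (2 * e + 2 * m)" if t: "t < nat (4 * m)" for t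
  proof (cases "even t")
    case True
    then obtain n where n: "t = 2 * n" by blast
    have "ty (y t) (y (Suc t)) \<longleftrightarrow> dl t mod ?M = dr (Suc t) mod ?M" using True k(2) by (simp add: y_def)
    also have "\<dots> \<longleftrightarrow> int n mod ?M = (2 * e - int n) mod ?M" unfolding dlmod by (simp add: n)
    also have "\<dots> \<longleftrightarrow> 2 * m dvd 2 * (int n - e)" by (simp add: mod_eq_dvd_iff algebra_simps)
    also have "\<dots> \<longleftrightarrow> m dvd int n - e" by (rule dvd_mult_cancel_left[THEN trans]) simp
    also have "\<dots> \<longleftrightarrow> int n = e \<or> int n = e + m"
    proof
      assume "m dvd int n - e"
      then obtain z where z: "int n - e = m * z" by blast
      have "2 * int n < 4 * m" using t n by simp
      hence "- m < m * z" "m * z < 2 * m" using z e by linarith+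
      hence "- 1 < z" "z < 2" using m_pos by (metis mult.right_neutral mult_less_cancel_left_pos mult_minus_right, metis mult.commute mult_less_cancel_left_pos)
      hence "z = 0 \<or> z = 1" by auto
      thus "int n = e \<or> int n = e + m" using z by auto
    qed auto
    finally show ?thesis using e n by auto
  next
    case False
    then obtain n where n: "t = 2 * n + 1" by (auto elim: oddE)
    have "ty (y t) (y (Suc t)) \<longleftrightarrow> dr t mod ?M = dl (Suc t) mod ?M" using False k(2) by (simp add: y_def)
    also have "\<dots> \<longleftrightarrow> (2 * e - int n) mod ?M = (int n + 1) mod ?M" unfolding dlmod by (simp add: n add.commute)
    also have "\<dots> \<longleftrightarrow> ?M dvd 2 * (e - int n) - 1" by (simp add: mod_eq_dvd_iff algebra_simps)
    finally have "\<not> ty (y t) (y (Suc t))"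
    proof -
      assume ty: "ty (y t) (y (Suc t)) \<longleftrightarrow> ?M dvd 2 * (e - int n) - 1"
      have "\<not> 2 dvd 2 * (e - int n) - 1" by presburger
      thus ?thesis using ty dvd_mult_left by blast
    qed
    moreover have "even (nat (2 * e))" "even (nat (2 * e + 2 * m))" using e by (simp_all add: even_nat_iff)
    ultimately show ?thesis using False by blast
  qed
  have "even (nat (2 * e)) = even (nat (2 * e + 2 * m))" using e by (simp add: even_nat_iff)
  hence "\<exists>t1 t2. t1 < t2 \<and> t2 < nat (4 * m) \<and> even t1 = even t2 \<and>
      (\<forall>t<nat (4 * m). ty (y t) (y (Suc t)) \<longleftrightarrow> t = t1 \<or> t = t2)"
    using y_ty e by (intro exI[of _ "nat (2 * e)"] exI[of _ "nat (2 * e + 2 * m)"]) simp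
  hence "alternating_cycle (nat (4 * m)) y (V - {Some (j, c)}) (nxt (Some (j, c))) (fwd (Some (j, c))) ty"
    unfolding alternating_cycle_def using y_in y_Suc y_inj y_fwd by blast
  moreover have "Some (i, d) \<in> range y"
  proof (cases "d div ?M = half j c i")
    case True
    have "y (2 * nat (d mod ?M)) = Some (i, d div ?M * ?M + d mod ?M)"
      using True bnd[of d] by (simp add: y_def dl_def i0_def)
    thus ?thesis by (metis div_mult_mod_eq rangeI)
  next
    case False
    have ki: "k = i" using False T_T'[OF j, of i] i by (simp add: k_def i0_def)
    have dd: "d div ?M = 1 - half j c k" using False div_2m[OF d] half_range[of j c i] ki by auto
    define n where "n = (2 * e - d) mod ?M"
    have "(2 * e - n) mod ?M = (2 * e - (2 * e - d)) mod ?M" unfolding n_def by (rule mod_diff_right_eq)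
    hence "y (2 * nat n + 1) = Some (i, d div ?M * ?M + d mod ?M)"
      using bnd[of "2 * e - d"] by (simp add: y_def dr_def ki dd n_def)
    thus ?thesis by (metis div_mult_mod_eq rangeI)
  qed
  ultimately show ?thesis by blast
qed

text \<open>The quasigroup yields \<open>j\<close>; the halves containing \<open>d\<close> and
  \<open>d'\<close> yield \<open>c mod 4\<close> by independence of the functionals;
  \<open>d + d'\<close> modulo \<open>2 * m\<close> yields \<open>c div 4\<close> and, by its
  parity, the direction of the trace.\<close>

lemma frame_arc:
  assumes i: "i \<in> {0..<x}" and k: "k \<in> {0..<x}" "i \<noteq> k" and d: "d \<in> {0..<4 * m}" and d': "d' \<in> {0..<4 * m}"
  shows "\<exists>p\<in>V. p \<noteq> Some (i, d) \<and> p \<noteq> Some (k, d') \<and>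
    ((nxt p (Some (i, d)) = Some (k, d') \<and> fwd p (Some (i, d))) \<or>
     (nxt p (Some (k, d')) = Some (i, d) \<and> \<not> fwd p (Some (k, d'))))"
proof -
  let ?M = "2 * m"
  have M: "0 < ?M" using m_pos by simp
  obtain j where j: "j \<in> {0..<x}" "j \<noteq> i" "j \<noteq> k" "T j i = k" using T_surj[OF i k] by blast
  have T'k: "T' j k = i" using T'_T[of j i] j i by auto
  have d'01: "1 - d' div ?M = 0 \<or> 1 - d' div ?M = 1" using div_2m[OF d'] by auto
  have "col j i \<noteq> col j k" using col_neq[of j i] j i by auto
  from functionals_independent[OF col_less col_less this div_2m[OF d] d'01]
  obtain f where f: "f \<in> {0..<4}" "functional (col j i) f = d div ?M" "functional (col j k) f = 1 - d' div ?M" by blast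
  define z where "z = (d + d') mod ?M"
  define e where "e = z div 2"
  have "0 \<le> z" "z < ?M" using M by (auto simp: z_def intro: pos_mod_bound)
  hence e: "0 \<le> e" "e < m" by (auto simp: e_def)
  define c where "c = 4 * e + f"
  have cm: "c mod 4 = f" "c div 4 = e" using f by (auto simp: c_def)
  have c: "c \<in> {0..<4 * m}" using e f by (auto simp: c_def)
  have hi: "half j c i = d div ?M" and hk: "half j c k = 1 - d' div ?M"
    using f by (auto simp: half_def cm)
  have p: "Some (j, c) \<in> V" using j c by (auto simp: V_def)
  show ?thesis
  proof (cases "even z")
    case True
    have "(2 * e - d) mod ?M = (z - d) mod ?M" using True by (simp add: e_def)
    also have "\<dots> = (d + d' - d) mod ?M" unfolding z_def by (rule mod_diff_left_eq)
    finally have "(2 * e - d) mod ?M = d' mod ?M" by simp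
    hence "frame_next j c i d = (k, d' div ?M * ?M + d' mod ?M)"
      by (simp add: frame_next_def hi hk cm j(4))
    hence "nxt (Some (j, c)) (Some (i, d)) = Some (k, d')" using j by (simp only: nxt.simps div_mult_mod_eq) simp
    moreover have "fwd (Some (j, c)) (Some (i, d))" using j by (simp add: hi)
    ultimately show ?thesis using p j by (intro bexI[of _ "Some (j, c)"]) auto
  next
    case False
    have nh: "d' div ?M \<noteq> half j c k" using div_2m[OF d'] hk by auto
    have "(2 * e - d' + 1) mod ?M = (z - d') mod ?M"
    proof -
      have "2 * e - d' + 1 = z - d'" using False unfolding e_def by presburger
      thus ?thesis by (rule arg_cong)
    qed
    also have "\<dots> = (d + d' - d') mod ?M" unfolding z_def by (rule mod_diff_left_eq)
    finally have "(2 * e - d' + 1) mod ?M = d mod ?M" by simp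
    hence "frame_next j c k d' = (i, d div ?M * ?M + d mod ?M)"
      using nh by (simp add: frame_next_def hi cm T'k)
    hence "nxt (Some (j, c)) (Some (k, d')) = Some (i, d)" using j by (simp only: nxt.simps div_mult_mod_eq) simp
    moreover have "\<not> fwd (Some (j, c)) (Some (k, d'))" using j nh by simp
    ultimately show ?thesis using p j by (intro bexI[of _ "Some (j, c)"]) auto
  qed
qed

lemma near_factorization_frame:
  assumes x: "0 < x"
  shows "near_factorization (nat (4 * m)) V nxt fwd ty"
proof
  interpret fill: near_factorization "nat (4 * m)" "{0..4 * m}" "fill_next m" "fill_fwd m" "fill_ty m"
    by (rule near_factorization_fill[OF m_pos])
  show "finite V" by (simp add: V_def)
  show "even (nat (4 * m))" "0 < nat (4 * m)" by (fact fill.even_r)+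
  show "ty a b = ty b a" for a b by (rule ty_sym)
  show "\<exists>y. alternating_cycle (nat (4 * m)) y (V - {p}) (nxt p) (fwd p) ty \<and> a \<in> range y"
    if "p \<in> V" "a \<in> V" "a \<noteq> p" for p a
    using x that(1,2)
  proof (cases rule: same_group_or_frame)
    case (group j l l')
    hence "l' \<noteq> l" using that by auto
    from fill.cycle[OF group(2,3) this] obtain c where
      c: "alternating_cycle (nat (4 * m)) c ({0..4 * m} - {l}) (fill_next m l) (fill_fwd m l) (fill_ty m)" "l' \<in> range c"
      by blast
    from c(1) have cn: "c t \<noteq> l" "c t \<in> {0..4 * m}" for t by (auto simp: alternating_cycle_def)
    have "alternating_cycle (nat (4 * m)) (point j \<circ> c) (V - {p}) (nxt p) (fwd p) ty"
      using c(1) cn point_in_V[OF group(1)]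
      by (simp add: alternating_cycle_def group point_simps[OF cn(1)[symmetric]] ty_point point_eq_iff)
    moreover have "a \<in> range (point j \<circ> c)" using c(2) group by auto
    ultimately show ?thesis by blast
  next
    case (frame j c i d)
    thus ?thesis using frame_cycle[of j c i d] by simp
  qed
  show "\<exists>p\<in>V. p \<noteq> a \<and> p \<noteq> b \<and> (nxt p a = b \<and> fwd p a \<or> nxt p b = a \<and> \<not> fwd p b)"
    if "a \<in> V" "b \<in> V" "a \<noteq> b" for a b
    using x that(1,2)
  proof (cases rule: same_group_or_frame)
    case (group j l l')
    hence "l \<noteq> l'" using that by auto
    from fill.arc[OF group(2,3) this] obtain q where q: "q \<in> {0..4 * m}" "q \<noteq> l" "q \<noteq> l'"
      "(fill_next m q l = l' \<and> fill_fwd m q l) \<or> (fill_next m q l' = l \<and> \<not> fill_fwd m q l')" by blast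
    thus ?thesis using point_in_V[OF group(1) q(1)] group
      by (intro bexI[of _ "point j q"]) (auto simp: point_simps point_eq_iff)
  next
    case (frame j c i d)
    thus ?thesis using frame_arc[of j i c d] by simp
  qed
qed

lemma card_V: "card V = nat (4 * m * x) + 1"
proof -
  have "card V = card ({0..<x} \<times> {0..<4 * m}) + 1"
    unfolding V_def by (subst card_insert_disjoint) (auto simp: card_image)
  thus ?thesis using m_pos nat_mult_distrib[of "4 * m" x] by (simp add: card_cartesian_product mult.commute)
qed

end

section \<open>Assembling the construction\<close>

lemma ex_near_factorization:
  fixes m x :: nat
  assumes m: "0 < m" and x: "0 < x" "x \<noteq> 2"
  shows "\<exists>nxt fwd ty. near_factorization (4 * m) {..<4 * m * x + 1} nxt fwd ty"
proof -
  have "0 < int x" "int x \<noteq> 2" using x by auto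
  then obtain T T' where T: "idempotent_action (int x) T T'" using ex_idempotent_action by blast
  \<comment> \<open>For \<open>j\<close> out of range the condition is void, so that a colouring can
    be chosen for all integers \<open>j\<close> at once.\<close>
  have "\<exists>col :: int \<Rightarrow> nat. (\<forall>i. col i < 3) \<and> (j \<in> {0..<int x} \<longrightarrow> (\<forall>i\<in>{0..<int x} - {j}. col i \<noteq> col (T j i)))" for j
  proof (cases "j \<in> {0..<int x}")
    case True
    have "\<exists>col :: int \<Rightarrow> nat. (\<forall>i. col i < 3) \<and>
        (\<forall>i\<in>{0..<int x} - {j}. T j i \<in> {0..<int x} - {j} \<longrightarrow> col i \<noteq> col (T j i))"
      using T True unfolding idempotent_action_def by (intro ex_three_colouring[where f' = "T' j"]) auto
    thus ?thesis using T True unfolding idempotent_action_def by metis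
  qed (auto intro: exI[of _ "\<lambda>_. 0"])
  then obtain col :: "int \<Rightarrow> int \<Rightarrow> nat" where
    "\<And>j i. col j i < 3" "\<And>j i. j \<in> {0..<int x} \<Longrightarrow> i \<in> {0..<int x} - {j} \<Longrightarrow> col j i \<noteq> col j (T j i)"
    by metis
  then interpret frame "int m" "int x" T T' col
    using T m by unfold_locales auto
  have nf: "near_factorization (4 * m) V nxt fwd ty"
    using near_factorization_frame x by (simp add: nat_mult_distrib)
  have "card V = 4 * m * x + 1"
    by (simp add: card_V nat_mult_distrib)
  hence "\<exists>f. bij_betw f V {..<4 * m * x + 1}"
    using near_factorization.finite_V[OF nf] by (intro finite_same_card_bij) auto
  thus ?thesis using near_factorization_transfer[OF nf] by blast
qed

theorem theorem4p8:
  fixes p :: "nat \<Rightarrow> nat" and t i k r s x u g :: nat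
  assumes "\<And>j. j \<in> {1..t} \<Longrightarrow> prime (p j)"
    and "k = (\<Prod>j = 1..t. p j)"
    and "[k = 0] (mod 4)"
    and "1 < i" and "i \<le> t - 1"
    and "r = (\<Prod>j = 1..i. p j)"
    and "s = (\<Prod>j = i + 1..t. p j)"
    and "0 < x" and "x \<noteq> 2"
    and "u = r * x + 1"
    and "odd g"
    and "[g = s] (mod (2 * s))"
  shows "\<exists>P. is_ARCS k u g P"
proof -
  have s_odd: "odd s"
  proof
    assume "even s"
    \<comment> \<open>The modulus \<open>2 * s\<close> is even, so the congruence preserves
      parity.\<close>
    moreover have "even g \<longleftrightarrow> even s"
      using assms(12) by (metis cong_def dvd_mod_iff dvd_triv_left)
    ultimately show False using \<open>odd g\<close> by blast
  qed
  have "{1..t} = {1..i} \<union> {i + 1..t}" using assms(4,5) by auto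
  hence k: "k = r * s" unfolding assms(2,6,7) by (simp add: prod.union_disjoint)
  have "coprime 4 s" using s_odd by (metis coprime_left_2_iff_odd coprime_power_left_iff numeral_Bit0 power2_eq_square mult_2 numeral_times_numeral num.distinct)
  moreover have "4 dvd r * s" using assms(3) k by (simp add: cong_0_iff)
  ultimately have "4 dvd r" by (simp add: coprime_dvd_mult_left_iff)
  then obtain m where m: "r = 4 * m" by blast
  have "r \<noteq> 0"
    unfolding assms(6) using assms(1,4,5) by (auto simp: prime_gt_0_nat)
  hence "0 < m" using m by simp
  from ex_near_factorization[OF this assms(8,9)] obtain nxt fwd ty where
    nf: "near_factorization r {..<u} nxt fwd ty" using m assms(10) by auto
  have "s dvd g" using assms(12) by (metis cong_dvd_iff dvd_refl cong_dvd_modulus_nat dvd_triv_right)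
  then obtain w where w: "g = s * w" by blast
  have "odd w" using \<open>odd g\<close> w by simp
  moreover have "0 < s" using s_odd by (intro Nat.gr0I) auto
  hence "r \<le> r * s" by simp
  hence "3 \<le> r * s" using \<open>0 < m\<close> m by linarith
  ultimately interpret lifted_factorization r u nxt fwd ty s w
    using nf s_odd by (intro lifted_factorization.intro lifted_factorization_axioms.intro)
  have "0 < r * x" using \<open>r \<noteq> 0\<close> assms(8) by simp
  hence "2 \<le> u" unfolding assms(10) by linarith
  from is_ARCS_lift[OF this] show ?thesis unfolding k w by blast
qed

end
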